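(* Consider Alpern's Caching Game $G(2,2,n,h)$ with $n\ge1$ holes and digging limit $h>0$. If the hider chooses $(y_1,y_2)$ uniformly at random from the triangle $\{y_1\ge 0,\ y_2\ge 0,\ y_1+y_2\le 1\}$ and then uses the basic strategy $(y_1,y_2)$, then, against any searching strategy, the searcher wins with probability at most $\frac{2h^2}{n(n+1)}$. If moreover $h$ is a positive integer and $h\le\frac{n+1}{2}$, then the bound is sharp, namely the value of the game is $v(2,2,n,h)=\frac{2h^2}{n(n+1)}$.
   Context: Alpern's Caching Game $G(2,2,n,h)$ ($n\ge 1$ integer, $h>0$ real): the hider places each of $2$ nuts into one of $n$ holes at a positive depth, so that the sum, over the non-empty holes, of the depth of the deepest nut in the hole is at most $1$ (a placement). The searcher observes nothing about the placement and digs in the holes (switching between holes at will, or digging several in parallel), with total digging at most $h$. A nut is found once its hole has been dug at least to the depth of the nut. The searching strategy is adaptive: the searcher continuously observes what he has found and where. The searcher wins if he finds both nuts; otherwise the hider wins. Both players may use mixed strategies (only those for which winning probabilities are defined). The value $v(2,2,n,h)$ is the value of this zero-sum game with payoff the winning probability of the searcher, i.e. the common value of $\sup$ over searching strategies of $\inf$ over placements, and $\inf$ over hiding strategies of $\sup$ over pure searching strategies. Basic strategy $(y_1,y_2)$ of the hider: he chooses a pair of holes, possibly the same hole twice, uniformly at random out of the $\binom{n+1}{2}$ multisets of two holes. If the two holes $x_1\ne x_2$ are different, he puts the two nuts either into hole $x_1$ at depth $y_1$ and hole $x_2$ at depth $y_2$, or into hole $x_1$ at depth $y_2$ and hole $x_2$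 at depth $y_1$, each with probability $\frac12$. If the same hole $x$ is chosen twice, he puts the two nuts into hole $x$ either at depths $y_1$ and $1$, or at depths $y_2$ and $1$, each with probability $\frac12$. *)

theory Defs
  imports "HOL-Probability.Probability"
begin

text \<open>
  A nut is a pair (hole, depth), the holes being the numbers below \<open>n\<close>. A placement is an ordered
  pair of nuts. The nuts are indistinguishable for the searcher: nothing below depends on the order
  of the two nuts.
\<close>

type_synonym nut = "nat \<times> real"
type_synonym placement = "nut \<times> nut"

definition placements :: "nat \<Rightarrow> placement set" where
  "placements n = {(p, q).
     (\<forall>u \<in> {p, q}. fst u < n \<and> 0 < snd u) \<and>
     (\<Sum>k \<in> fst ` {p, q}. Max (snd ` {u \<in> {p, q}. fst u = k})) \<le> 1}"

text \<open>
  A digging path gives the depth \<open>p t i\<close> of hole \<open>i\<close> at time \<open>t\<close>. Time is normalised so that the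
  searcher digs at total speed at most one; hence the limit \<open>h\<close> on the total digging becomes the
  time horizon \<open>h\<close>. Slower digging, idling and stopping early are allowed.
\<close>

type_synonym path = "real \<Rightarrow> nat \<Rightarrow> real"

definition digging :: "nat \<Rightarrow> real \<Rightarrow> real \<Rightarrow> path \<Rightarrow> bool" where
  "digging n s t p \<longleftrightarrow> (\<forall>u v. s \<le> u \<longrightarrow> u \<le> v \<longrightarrow> v \<le> t \<longrightarrow>
     (\<forall>i<n. p u i \<le> p v i) \<and> (\<Sum>i<n. p v i - p u i) \<le> v - u)"

text \<open>
  A pure searching strategy \<open>(a, b)\<close> consists of the path \<open>a\<close> followed until the first nut is found
  and, for every time \<open>t\<close> and hole \<open>i\<close>, the path \<open>b t i\<close> followed from time \<open>t\<close> on if the first nut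
  is found at time \<open>t\<close> in hole \<open>i\<close> (so at depth \<open>a t i\<close>). If both nuts are found at the same moment,
  the game is over. So all that the searcher can react to is \<open>(t, i)\<close>.
\<close>

type_synonym strategy = "path \<times> (real \<Rightarrow> nat \<Rightarrow> path)"

definition found_at :: "path \<Rightarrow> nut \<Rightarrow> real \<Rightarrow> bool" where
  "found_at a u t \<longleftrightarrow> snd u \<le> a t (fst u) \<and> (\<forall>s. 0 \<le> s \<longrightarrow> s < t \<longrightarrow> a s (fst u) < snd u)"

definition wins :: "real \<Rightarrow> strategy \<Rightarrow> placement \<Rightarrow> bool" where
  "wins h = (\<lambda>(a, b) (p, q).
     \<exists>t \<in> {0..h}. \<exists>(u, v) \<in> {(p, q), (q, p)}.
       found_at a u t \<and>
       (found_at a v t \<or> (a t (fst v) < snd v \<and> snd v \<le> b t (fst u) h (fst v))))"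

definition win_set :: "nat \<Rightarrow> real \<Rightarrow> strategy \<Rightarrow> placement set" where
  "win_set n h s = {x \<in> placements n. wins h s x}"

text \<open>
  The last condition says that the winning probability of the strategy is defined against every
  Borel distribution of placements.
\<close>

definition pure_strategies :: "nat \<Rightarrow> real \<Rightarrow> strategy set" where
  "pure_strategies n h = {(a, b).
     digging n 0 h a \<and> (\<forall>i<n. a 0 i = 0) \<and>
     (\<forall>t \<in> {0..h}. \<forall>i<n. digging n t h (b t i) \<and> (\<forall>j<n. b t i t j = a t j)) \<and>
     win_set n h (a, b) \<in> sets borel}"

definition hiding_strategies :: "nat \<Rightarrow> placement measure set" where
  "hiding_strategies n =
     {\<mu>. prob_space \<mu> \<and> sets \<mu> = sets borel \<and> (AE x in \<mu>. x \<in> placements n)}"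

text \<open>
  Mixed searching strategies are probability measures, with respect to any \<open>\<sigma>\<close>-algebra, on sets of
  pure strategies, such that the winning probability against every hiding strategy is defined. The
  pure strategy \<open>s\<close> corresponds to \<open>count_space {s}\<close>.
\<close>

definition search_strategies :: "nat \<Rightarrow> real \<Rightarrow> strategy measure set" where
  "search_strategies n h =
     {\<sigma>. prob_space \<sigma> \<and> space \<sigma> \<subseteq> pure_strategies n h \<and>
         (SIGMA s:space \<sigma>. win_set n h s) \<in> sets (\<sigma> \<Otimes>\<^sub>M borel)}"

definition win_prob :: "nat \<Rightarrow> real \<Rightarrow> strategy measure \<Rightarrow> placement measure \<Rightarrow> real" where
  "win_prob n h \<sigma> \<mu> = measure (\<sigma> \<Otimes>\<^sub>M \<mu>) (SIGMA s:space \<sigma>. win_set n h s)"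

definition lower_value :: "nat \<Rightarrow> real \<Rightarrow> real" where
  "lower_value n h =
     (SUP \<sigma> \<in> search_strategies n h. INF x \<in> placements n. measure \<sigma> {s \<in> space \<sigma>. wins h s x})"

definition upper_value :: "nat \<Rightarrow> real \<Rightarrow> real" where
  "upper_value n h =
     (INF \<mu> \<in> hiding_strategies n. SUP s \<in> pure_strategies n h. measure \<mu> (win_set n h s))"

definition has_value :: "nat \<Rightarrow> real \<Rightarrow> real \<Rightarrow> bool" where
  "has_value n h v \<longleftrightarrow> lower_value n h = v \<and> upper_value n h = v"

text \<open>The multiset of the holes \<open>x1\<close> and \<open>x2\<close> is represented by the pair with \<open>x1 \<le> x2\<close>.\<close>

definition basic_strategy :: "nat \<Rightarrow> real \<Rightarrow> real \<Rightarrow> placement pmf" where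
  "basic_strategy n y1 y2 =
     bind_pmf (pmf_of_set {(x1, x2). x1 \<le> x2 \<and> x2 < n}) (\<lambda>(x1, x2).
     bind_pmf (bernoulli_pmf (1/2)) (\<lambda>c.
     return_pmf (
       if x1 \<noteq> x2 then (if c then ((x1, y1), (x2, y2)) else ((x1, y2), (x2, y1)))
       else (if c then ((x1, y1), (x1, 1)) else ((x1, y2), (x1, 1))))))"

definition unit_triangle :: "(real \<times> real) set" where
  "unit_triangle = {(y1, y2). 0 \<le> y1 \<and> 0 \<le> y2 \<and> y1 + y2 \<le> 1}"

definition uniform_basic_strategy :: "nat \<Rightarrow> placement measure" where
  "uniform_basic_strategy n =
     uniform_measure lborel unit_triangle \<bind>
       (\<lambda>(y1, y2). distr (measure_pmf (basic_strategy n y1 y2)) borel (\<lambda>x. x))"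

end

theory Submission
  imports Defs
begin

text \<open>
  Against the random basic strategy the probability density of finding the first nut in hole \<open>i\<close> at
  depth \<open>y\<close>, at time \<open>t\<close>, and then winning is, up to the factor \<open>4 / (n * (n + 1))\<close> coming from the
  choice of the holes and the area of the triangle, bounded by the remaining digging \<open>h - t\<close>: in another
  hole the depth of the second nut is uniformly distributed, and the weight \<open>1 - y\<close> of a second nut
  at depth 1 of hole \<open>i\<close> is just what it costs to dig for it. Integrating \<open>h - t\<close> along the path gives
  \<open>h\<^sup>2 / 2\<close>.

  An optimal searcher wastes no digging: he digs \<open>h\<close> random holes in parallel, and when the first nut
  is found at depth \<open>y\<close>, the remaining \<open>h * (1 - y)\<close> suffices to dig \<open>h\<close> holes by a further \<open>1 - y\<close>.
  They are chosen at random among the hole of the first nut and the \<open>n - h\<close> untouched holes, which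
  is possible as \<open>h \<le> n - h + 1\<close>.
\<close>

subsection \<open>Pure searching strategies\<close>

text \<open>The continuation paths cannot be integrated directly: the dependence of
  \<open>b t i\<close> on \<open>t\<close> is arbitrary, and only the win set as a whole is known to
  be Borel. So slices of the win set are measured instead. Each slice lies in an interval whose
  length is what \<open>b t i\<close> digs in that hole, and the resulting bound is pointwise in the
  depth \<open>y\<close> of the first nut. Likewise the time of discovery is replaced by the
  remaining time, which is measurable in \<open>y\<close> and also decides which nut comes first.

  The constant: for two different holes \<open>i\<close> and \<open>j\<close>, each ordered
  discovery has density \<open>4 / (n * (n + 1))\<close>, and
  \<open>4 / (n * (n + 1)) * h^2 / 2\<close> is the bound.

  If the parallel searcher digs on in the hole of the first nut with probability \<open>r\<close>,
  he wins with probability at least \<open>r * m / n\<close> against nuts in one hole, and at least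
  \<open>2 * m * (m - r) / (n * (n - 1))\<close> against nuts in two holes, \<open>m - r\<close>
  being the mean number of fresh holes. Equating the two gives \<open>r = 2 * m / (n + 1)\<close>,
  and both become \<open>2 * m^2 / (n * (n + 1))\<close>.\<close>

lemma digging_mono:
  assumes "digging n s t p" "s \<le> u" "u \<le> v" "v \<le> t" "i < n"
  shows "p u i \<le> p v i"
  using assms unfolding digging_def by blast

lemma digging_sum_le:
  assumes "digging n s t p" "s \<le> u" "u \<le> v" "v \<le> t"
  shows "(\<Sum>i<n. p v i - p u i) \<le> v - u"
  using assms unfolding digging_def by blast

text \<open>The increments of the other holes are nonnegative. This supplies the continuity in time
  on which exact discovery depths and strict comparisons of times rest.\<close>

lemma digging_lipschitz:
  assumes "digging n s t p" "s \<le> u" "u \<le> v" "v \<le> t" "i < n"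
  shows "p v i - p u i \<le> v - u"
proof -
  have "p v i - p u i \<le> (\<Sum>i<n. p v i - p u i)"
    using assms digging_mono[OF assms(1-4)] by (intro member_le_sum) auto
  also have "\<dots> \<le> v - u"
    using assms by (intro digging_sum_le)
  finally show ?thesis .
qed

lemma found_at_unique:
  assumes "found_at a u s" "found_at a u t" "0 \<le> s" "0 \<le> t"
  shows "s = t"
  using assms unfolding found_at_def by (metis linorder_not_le nle_le)

lemma found_at_depth:
  assumes "digging n 0 h a" "a 0 i = 0" "i < n" "0 < y" "0 \<le> t" "t \<le> h" "found_at a (i, y) t"
  shows "a t i = y"
proof (rule ccontr)
  assume "a t i \<noteq> y"
  moreover have "y \<le> a t i"
    using assms(7) by (simp add: found_at_def)
  ultimately have gt: "y < a t i" by simp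
  then have "t \<noteq> 0"
    using assms by auto
  \<comment> \<open>Going back in time by the excess \<open>a t i - y\<close> cannot take the hole
    above depth \<open>y\<close> again, by the speed limit; so depth \<open>y\<close> was already
    reached at \<open>s\<close>, before the supposed first time.\<close>
  define s where "s = max 0 (t - (a t i - y))"
  have s: "0 \<le> s" "s < t"
    using gt assms \<open>t \<noteq> 0\<close> by (auto simp: s_def)
  then have "a s i < y"
    using assms(7) by (auto simp: found_at_def)
  moreover have "a t i - a s i \<le> t - s"
    using s assms by (intro digging_lipschitz[OF assms(1)]) auto
  ultimately show False
    unfolding s_def by linarith
qed

lemma wins_iff:
  "wins h (a, b) (p, q) \<longleftrightarrow>
    (\<exists>t\<in>{0..h}. found_at a p t \<and> (found_at a q t \<or> a t (fst q) < snd q \<and> snd q \<le> b t (fst p) h (fst q))) \<or>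
    (\<exists>t\<in>{0..h}. found_at a q t \<and> (found_at a p t \<or> a t (fst p) < snd p \<and> snd p \<le> b t (fst q) h (fst p)))"
proof -
  have "(\<exists>(u, v)\<in>{(p, q), (q, p)}. W u v) \<longleftrightarrow> W p q \<or> W q p" for W
    by auto
  then show ?thesis
    unfolding wins_def prod.case by blast
qed

lemma winsE:
  assumes "wins h (a, b) (p, q)"
  obtains u v t where "(u, v) = (p, q) \<or> (u, v) = (q, p)" "t \<in> {0..h}" "found_at a u t"
    "found_at a v t \<or> a t (fst v) < snd v \<and> snd v \<le> b t (fst u) h (fst v)"
  using assms that[of p q] that[of q p] unfolding wins_iff by blast

lemma win_set_swap: "(p, q) \<in> win_set n h s \<longleftrightarrow> (q, p) \<in> win_set n h s"
proof -
  have "(p, q) \<in> placements n \<longleftrightarrow> (q, p) \<in> placements n"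
    unfolding placements_def mem_Collect_eq prod.case insert_commute[of p q "{}"] ..
  moreover have "wins h s (p, q) \<longleftrightarrow> wins h s (q, p)"
    by (cases s) (auto simp: wins_iff)
  ultimately show ?thesis
    by (simp add: win_set_def)
qed

lemma placements_distinct_iff:
  assumes "i \<noteq> j"
  shows "((i, y), (j, z)) \<in> placements n \<longleftrightarrow> i < n \<and> j < n \<and> 0 < y \<and> 0 < z \<and> y + z \<le> 1"
proof -
  have "{u \<in> {(i, y), (j, z)}. fst u = i} = {(i, y)}" "{u \<in> {(i, y), (j, z)}. fst u = j} = {(j, z)}"
    using assms by auto
  then show ?thesis
    using assms by (auto simp: placements_def)
qed

lemma placements_same_iff:
  "((i, y), (i, z)) \<in> placements n \<longleftrightarrow> i < n \<and> 0 < y \<and> 0 < z \<and> y \<le> 1 \<and> z \<le> 1"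
proof -
  have "{u \<in> {(i, y), (i, z)}. fst u = i} = {(i, y), (i, z)}"
    by auto
  then show ?thesis
    by (auto simp: placements_def)
qed

lemma placements_pos:
  assumes "((i, y), (j, z)) \<in> placements n"
  shows "i < n" "j < n" "0 < y" "0 < z"
  using assms by (auto simp: placements_def)

locale pure_search =
  fixes n :: nat and h :: real and a :: path and b :: "real \<Rightarrow> nat \<Rightarrow> path"
  assumes strategy: "(a, b) \<in> pure_strategies n h"
    and h_pos: "0 < h"
begin

lemma dig_a: "digging n 0 h a"
  and a_0: "i < n \<Longrightarrow> a 0 i = 0"
  and dig_b: "t \<in> {0..h} \<Longrightarrow> i < n \<Longrightarrow> digging n t h (b t i)"
  and b_start: "t \<in> {0..h} \<Longrightarrow> i < n \<Longrightarrow> j < n \<Longrightarrow> b t i t j = a t j"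
  and win_set_borel: "win_set n h (a, b) \<in> sets borel"
  using strategy by (auto simp: pure_strategies_def)

lemma a_mono: "0 \<le> u \<Longrightarrow> u \<le> v \<Longrightarrow> v \<le> h \<Longrightarrow> i < n \<Longrightarrow> a u i \<le> a v i"
  using digging_mono[OF dig_a] .

lemma a_nonneg: "0 \<le> t \<Longrightarrow> t \<le> h \<Longrightarrow> i < n \<Longrightarrow> 0 \<le> a t i"
  using a_mono[of 0 t i] a_0 by simp

lemma a_sum_le: "0 \<le> t \<Longrightarrow> t \<le> h \<Longrightarrow> (\<Sum>i<n. a t i) \<le> t"
  using digging_sum_le[OF dig_a, of 0 t] a_0 by simp

lemma b_ge: "t \<in> {0..h} \<Longrightarrow> i < n \<Longrightarrow> j < n \<Longrightarrow> a t j \<le> b t i h j"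
  using digging_mono[OF dig_b, of t i t h j] b_start by simp

lemma b_sum_le: "t \<in> {0..h} \<Longrightarrow> i < n \<Longrightarrow> (\<Sum>j<n. b t i h j - a t j) \<le> h - t"
  using digging_sum_le[OF dig_b, of t i t h] b_start by simp

lemma found_depth: "found_at a (i, y) t \<Longrightarrow> t \<in> {0..h} \<Longrightarrow> i < n \<Longrightarrow> 0 < y \<Longrightarrow> a t i = y"
  using found_at_depth[OF dig_a] a_0 by simp

text \<open>
  The time that is left when hole \<open>i\<close> is dug to depth \<open>y\<close> (see \<open>reach_found\<close>). As the measure of a
  slice it is measurable in \<open>y\<close>, and its integral over \<open>y\<close> is the integral of \<open>a\<close> over time.
\<close>

definition reach :: "nat \<Rightarrow> real \<Rightarrow> ennreal" where
  "reach i y = emeasure lborel {t \<in> {0..h}. 0 < y \<and> y \<le> a t i}"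

definition win_pairs :: "nat \<Rightarrow> nat \<Rightarrow> (real \<times> real) set" where
  "win_pairs i j = {(y, z). ((i, y), (j, z)) \<in> win_set n h (a, b)}"

text \<open>The order of discovery is encoded by remaining times, which keeps the set measurable.
  Ties belong to both orders; this is harmless for an upper bound.\<close>

definition first_pairs :: "nat \<Rightarrow> nat \<Rightarrow> (real \<times> real) set" where
  "first_pairs i j = {(y, z) \<in> win_pairs i j. reach j z \<le> reach i y}"

definition deep_wins :: "nat \<Rightarrow> real set" where
  "deep_wins i = {y. ((i, y), (i, 1)) \<in> win_set n h (a, b)}"

lemma reach_found:
  assumes "found_at a (i, y) t" "t \<in> {0..h}" "i < n" "0 < y"
  shows "reach i y = ennreal (h - t)"
proof -
  have "{t \<in> {0..h}. 0 < y \<and> y \<le> a t i} = {t..h}"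
  proof (intro set_eqI iffI)
    fix s assume "s \<in> {t..h}"
    then show "s \<in> {t \<in> {0..h}. 0 < y \<and> y \<le> a t i}"
      using assms a_mono[of t s i] by (auto simp: found_at_def)
  next
    fix s assume s: "s \<in> {t \<in> {0..h}. 0 < y \<and> y \<le> a t i}"
    then have "\<not> s < t"
      using assms(1) unfolding found_at_def by fastforce
    with s show "s \<in> {t..h}"
      by simp
  qed
  then show ?thesis
    using assms by (simp add: reach_def)
qed

text \<open>By the speed limit the hole stays above depth \<open>y\<close> for some positive time
  after \<open>t\<close>. Strictness is the point: it rules out that a nut still buried at
  \<open>t\<close> ties with one found at \<open>t\<close>.\<close>

lemma reach_less:
  assumes "a t i < y" "0 \<le> t" "t < h" "i < n"
  shows "reach i y < ennreal (h - t)"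
proof -
  define e where "e = min (y - a t i) (h - t) / 2"
  have e: "0 < e" "t + e \<le> h" "a t i + e < y"
    using assms by (auto simp: e_def min_def field_simps)
  have "{t \<in> {0..h}. 0 < y \<and> y \<le> a t i} \<subseteq> {t + e..h}"
  proof
    fix s assume s: "s \<in> {t \<in> {0..h}. 0 < y \<and> y \<le> a t i}"
    show "s \<in> {t + e..h}"
    proof (rule ccontr)
      assume "s \<notin> {t + e..h}"
      then have "s < t + e"
        using s by auto
      then have "a s i \<le> a (t + e) i"
        using s assms e by (intro a_mono) auto
      also have "\<dots> \<le> a t i + e"
        using digging_lipschitz[OF dig_a, of t "t + e" i] assms e by simp
      finally show False
        using e s by auto
    qed
  qed
  then have "reach i y \<le> emeasure lborel {t + e..h}"
    unfolding reach_def by (intro emeasure_mono) auto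
  also have "\<dots> < ennreal (h - t)"
    using e assms by (simp add: ennreal_less_iff)
  finally show ?thesis .
qed

text \<open>If the nut in hole \<open>j\<close> were found strictly first, hole \<open>i\<close>
  would have strictly less time left, against the definition of \<open>first_pairs\<close>. The
  closed lower end of the interval covers simultaneous discovery, where
  \<open>z = a t j\<close>.\<close>

lemma first_pairs_found:
  assumes "(y, z) \<in> first_pairs i j"
  shows "\<exists>t\<in>{0..h}. found_at a (i, y) t \<and> z \<in> {a t j..b t i h j}"
proof -
  have win: "wins h (a, b) ((i, y), (j, z))"
    and le: "reach j z \<le> reach i y"
    and pl: "i < n" "j < n" "0 < y" "0 < z"
    using assms by (auto simp: first_pairs_def win_pairs_def win_set_def dest: placements_pos)
  have both: ?thesis if "t \<in> {0..h}" "found_at a (i, y) t" "found_at a (j, z) t" for t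
    using that found_depth[of j z t] b_ge[of t i j] pl by auto
  from win obtain u v t where t: "t \<in> {0..h}" "found_at a u t"
    "found_at a v t \<or> a t (fst v) < snd v \<and> snd v \<le> b t (fst u) h (fst v)"
    and uv: "(u, v) = ((i, y), (j, z)) \<or> (u, v) = ((j, z), (i, y))"
    by (rule winsE)
  from uv show ?thesis
  proof
    assume "(u, v) = ((i, y), (j, z))"
    then show ?thesis
      using t both by auto
  next
    assume uv: "(u, v) = ((j, z), (i, y))"
    show ?thesis
    proof (cases "found_at a v t")
      case True
      then show ?thesis
        using t uv both by auto
    next
      case False
      then have lt: "a t i < y" "y \<le> b t j h i"
        using t uv by auto
      \<comment> \<open>At time \<open>h\<close> the continuation has no time to dig, so it cannot
        reach a nut that is still buried.\<close>
      have "t \<noteq> h"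
        using lt b_start[of h j i] pl h_pos by auto
      then have "reach i y < ennreal (h - t)"
        using lt t pl by (intro reach_less) auto
      moreover have "reach j z = ennreal (h - t)"
        using t uv pl by (intro reach_found) auto
      ultimately show ?thesis
        using le by simp
    qed
  qed
qed

text \<open>Within one hole the shallower nut is found first: when depth 1 is reached, the hole has
  long passed \<open>y\<close>. The hypothesis \<open>y < 1\<close> excludes finding both at once,
  in which case no continuation would be followed.\<close>

lemma deep_wins_found:
  assumes "y \<in> deep_wins i" "y < 1"
  shows "\<exists>t\<in>{0..h}. found_at a (i, y) t \<and> 1 \<le> b t i h i"
proof -
  have win: "wins h (a, b) ((i, y), (i, 1))" and pl: "i < n" "0 < y"
    using assms by (auto simp: deep_wins_def win_set_def dest: placements_pos)
  have one: "y < a t i" if "t \<in> {0..h}" "found_at a (i, 1) t" for t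
    using that found_depth[of i 1 t] pl assms by auto
  have "\<not> found_at a (i, y) t" if "t \<in> {0..h}" "found_at a (i, 1) t" for t
    using one[OF that] that found_depth[of i y t] pl assms by auto
  note not_first = this
  from win obtain u v t where t: "t \<in> {0..h}" "found_at a u t"
    "found_at a v t \<or> a t (fst v) < snd v \<and> snd v \<le> b t (fst u) h (fst v)"
    and uv: "(u, v) = ((i, y), (i, 1)) \<or> (u, v) = ((i, 1), (i, y))"
    by (rule winsE)
  from uv show ?thesis
  proof
    assume "(u, v) = ((i, y), (i, 1))"
    then show ?thesis
      using t not_first[of t] by auto
  next
    assume "(u, v) = ((i, 1), (i, y))"
    then show ?thesis
      using t not_first[of t] one[of t] by auto
  qed
qed

section \<open>Measurability of the win sections and of the remaining time\<close>

lemma win_pairs_measurable [measurable]: "win_pairs i j \<in> sets (borel \<Otimes>\<^sub>M borel)"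
proof -
  have "(\<lambda>x::real \<times> real. ((i, fst x), (j, snd x))) \<in> borel_measurable borel"
    by (intro borel_measurable_continuous_onI continuous_intros)
  from measurable_sets[OF this win_set_borel]
  have "(\<lambda>x. ((i, fst x), (j, snd x))) -` win_set n h (a, b) \<in> sets borel"
    by simp
  also have "(\<lambda>x. ((i, fst x), (j, snd x))) -` win_set n h (a, b) = win_pairs i j"
    by (auto simp: win_pairs_def)
  finally show ?thesis
    unfolding borel_prod .
qed

lemma deep_wins_measurable [measurable]: "deep_wins i \<in> sets borel"
proof -
  have "(\<lambda>x::real. ((i, x), (i, 1::real))) \<in> borel_measurable borel"
    by (intro borel_measurable_continuous_onI continuous_intros)
  from measurable_sets[OF this win_set_borel] show ?thesis
    by (simp add: deep_wins_def vimage_def)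
qed

text \<open>A path is constrained only on \<open>{0..h}\<close>; clamping the time makes it monotone
  on the whole line, hence Borel.\<close>

lemma borel_measurable_clamped:
  assumes "i < n"
  shows "(\<lambda>t. a (max 0 (min h t)) i) \<in> borel_measurable borel"
  using assms h_pos by (intro borel_measurable_mono monoI a_mono) (auto simp: min_def max_def)

lemma dug_region_measurable:
  assumes "i < n"
  shows "{(y, t). t \<in> {0..h} \<and> 0 < y \<and> y \<le> a t i} \<in> sets (borel \<Otimes>\<^sub>M borel)"
proof -
  define c where "c = (\<lambda>t. a (max 0 (min h t)) i)"
  have [measurable]: "c \<in> borel_measurable borel"
    unfolding c_def using assms by (rule borel_measurable_clamped)
  have "{(y, t). t \<in> {0..h} \<and> 0 < y \<and> y \<le> a t i} =
      {x \<in> space (borel \<Otimes>\<^sub>M borel). snd x \<in> {0..h} \<and> 0 < fst x \<and> fst x \<le> c (snd x)}"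
    by (auto simp: c_def space_pair_measure)
  also have "\<dots> \<in> sets (borel \<Otimes>\<^sub>M borel)"
    by measurable
  finally show ?thesis .
qed

lemma reach_measurable:
  assumes "i < n"
  shows "reach i \<in> borel_measurable borel"
proof -
  have "(\<lambda>y. emeasure lborel (Pair y -` {(y, t). t \<in> {0..h} \<and> 0 < y \<and> y \<le> a t i}))
      \<in> borel_measurable borel"
    using dug_region_measurable[OF assms]
    by (intro lborel.measurable_emeasure_Pair) (simp cong: sets_pair_measure_cong)
  also have "(\<lambda>y. emeasure lborel (Pair y -` {(y, t). t \<in> {0..h} \<and> 0 < y \<and> y \<le> a t i})) = reach i"
    by (simp add: reach_def vimage_def fun_eq_iff)
  finally show ?thesis .
qed

lemma first_pairs_measurable:
  assumes "i < n" "j < n"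
  shows "first_pairs i j \<in> sets (borel \<Otimes>\<^sub>M borel)"
proof -
  note [measurable] = reach_measurable[OF assms(1)] reach_measurable[OF assms(2)]
  have "first_pairs i j =
      win_pairs i j \<inter> {x \<in> space (borel \<Otimes>\<^sub>M borel). reach j (snd x) \<le> reach i (fst x)}"
    by (auto simp: first_pairs_def space_pair_measure)
  also have "\<dots> \<in> sets (borel \<Otimes>\<^sub>M borel)"
    by measurable
  finally show ?thesis .
qed

text \<open>
  Once the first nut has been found in hole \<open>i\<close> at time \<open>t\<close>, the remaining digging \<open>h - t = reach i y\<close>
  is shared between the candidates for the second nut: the other holes, and hole \<open>i\<close>, in which
  \<open>1 - y\<close> has to be dug.
\<close>

lemma slice_bound:
  assumes "i < n"
  shows "(\<Sum>j\<in>{..<n} - {i}. emeasure lborel (Pair y -` first_pairs i j))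
      + ennreal (1 - y) * indicator (deep_wins i) y \<le> reach i y"
proof (cases "0 < y \<and> (\<exists>t\<in>{0..h}. found_at a (i, y) t)")
  case True
  then obtain t where t: "t \<in> {0..h}" "found_at a (i, y) t" and y: "0 < y" by auto
  have unique: "s = t" if "s \<in> {0..h}" "found_at a (i, y) s" for s
    using that t found_at_unique[of a "(i, y)" s t] by auto
  have depth: "a t i = y"
    using t y assms found_depth[of i y t] by auto
  \<comment> \<open>As the discovery time is unique, all intervals below start from the same
    \<open>t\<close>, and their lengths add up to the digging done after \<open>t\<close>.\<close>
  have "emeasure lborel (Pair y -` first_pairs i j) \<le> ennreal (b t i h j - a t j)"
    if "j < n" for j
  proof -
    have "Pair y -` first_pairs i j \<subseteq> {a t j..b t i h j}"
      using first_pairs_found unique by fastforce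
    then have "emeasure lborel (Pair y -` first_pairs i j) \<le> emeasure lborel {a t j..b t i h j}"
      by (intro emeasure_mono) auto
    then show ?thesis
      using b_ge[OF t(1) assms that] by simp
  qed
  moreover have "ennreal (1 - y) * indicator (deep_wins i) y \<le> ennreal (b t i h i - a t i)"
  \<comment> \<open>For \<open>y\<close> at least 1 the weight \<open>ennreal (1 - y)\<close>
    truncates to 0.\<close>
  proof (cases "y \<in> deep_wins i \<and> y < 1")
    case True
    then have "1 \<le> b t i h i"
      using deep_wins_found unique by blast
    then show ?thesis
      using True depth by (auto intro!: ennreal_leI)
  next
    case False
    then show ?thesis
      by (auto simp: indicator_def ennreal_neg)
  qed
  ultimately have "(\<Sum>j\<in>{..<n} - {i}. emeasure lborel (Pair y -` first_pairs i j))
      + ennreal (1 - y) * indicator (deep_wins i) y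
      \<le> (\<Sum>j\<in>{..<n} - {i}. ennreal (b t i h j - a t j)) + ennreal (b t i h i - a t i)"
    by (intro add_mono sum_mono) auto
  also have "\<dots> = (\<Sum>j<n. ennreal (b t i h j - a t j))"
    using assms by (subst (2) sum.remove[of _ i]) (auto simp: add.commute)
  also have "\<dots> = ennreal (\<Sum>j<n. b t i h j - a t j)"
    using t assms b_ge by (intro sum_ennreal) auto
  also have "\<dots> \<le> ennreal (h - t)"
    using t assms by (intro ennreal_leI b_sum_le) auto
  also have "\<dots> = reach i y"
    using t y assms by (simp add: reach_found)
  finally show ?thesis .
next
  case False
  \<comment> \<open>Depth \<open>y\<close> of hole \<open>i\<close> is never uncovered before the
    second phase, so no win can begin there and the left side vanishes.\<close>
  have "Pair y -` first_pairs i j = {}" for j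
  proof -
    have "0 < y" if "(y, z) \<in> first_pairs i j" for z
      using that by (auto simp: first_pairs_def win_pairs_def win_set_def dest: placements_pos)
    then show ?thesis
      using False first_pairs_found by fastforce
  qed
  moreover have "ennreal (1 - y) * indicator (deep_wins i) y = 0"
  proof (cases "y \<in> deep_wins i \<and> y < 1")
    case True
    then have "0 < y"
      by (auto simp: deep_wins_def win_set_def dest: placements_pos)
    then show ?thesis
      using True False deep_wins_found by blast
  next
    case False
    then show ?thesis
      by (auto simp: indicator_def ennreal_neg)
  qed
  ultimately show ?thesis
    by (simp only: emeasure_empty sum.neutral_const add_0 zero_le)
qed

text \<open>Tonelli: both sides are the area of the region of dug depths and times, sliced in the
  two directions.\<close>

lemma nn_integral_reach:
  assumes "i < n"
  shows "(\<integral>\<^sup>+y. reach i y \<partial>lborel) = (\<integral>\<^sup>+t. ennreal (a t i) * indicator {0..h} t \<partial>lborel)"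
proof -
  let ?R = "{(y, t). t \<in> {0..h} \<and> 0 < y \<and> y \<le> a t i}"
  have R: "?R \<in> sets (lborel \<Otimes>\<^sub>M lborel)"
    using dug_region_measurable[OF assms] by (simp cong: sets_pair_measure_cong)
  have "(\<integral>\<^sup>+y. reach i y \<partial>lborel) = emeasure (lborel \<Otimes>\<^sub>M lborel) ?R"
    by (subst lborel.emeasure_pair_measure_alt[OF R]) (simp add: reach_def[abs_def] vimage_def)
  also have "\<dots> = (\<integral>\<^sup>+t. emeasure lborel ((\<lambda>y. (y, t)) -` ?R) \<partial>lborel)"
    by (rule lborel_pair.emeasure_pair_measure_alt2[OF R])
  also have "\<dots> = (\<integral>\<^sup>+t. ennreal (a t i) * indicator {0..h} t \<partial>lborel)"
  proof (intro nn_integral_cong)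
    fix t :: real
    show "emeasure lborel ((\<lambda>y. (y, t)) -` ?R) = ennreal (a t i) * indicator {0..h} t"
    proof (cases "t \<in> {0..h}")
      case True
      then have "(\<lambda>y. (y, t)) -` ?R = {0<..a t i}"
        by auto
      then show ?thesis
        using True a_nonneg[of t i] assms by simp
    next
      case False
      then have empty: "(\<lambda>y. (y, t)) -` ?R = {}"
        by auto
      show ?thesis
        unfolding empty using False by (simp add: indicator_def)
    qed
  qed
  finally show ?thesis .
qed

text \<open>The total depth at time \<open>t\<close> is at most \<open>t\<close>, and
  \<open>t\<close> integrates to \<open>h^2 / 2\<close> over \<open>{0..h}\<close>.\<close>

lemma sum_nn_integral_reach: "(\<Sum>i<n. \<integral>\<^sup>+y. reach i y \<partial>lborel) \<le> ennreal (h\<^sup>2 / 2)"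
proof -
  have "(\<lambda>t. ennreal (a t i) * indicator {0..h} t) \<in> borel_measurable borel" if "i < n" for i
  proof -
    note [measurable] = borel_measurable_clamped[OF that]
    have "(\<lambda>t. ennreal (a t i) * indicator {0..h} t) =
        (\<lambda>t. ennreal (a (max 0 (min h t)) i) * indicator {0..h} t)"
      by (auto simp: fun_eq_iff indicator_def)
    then show ?thesis
      by simp
  qed
  then have "(\<Sum>i<n. \<integral>\<^sup>+y. reach i y \<partial>lborel) =
      (\<integral>\<^sup>+t. (\<Sum>i<n. ennreal (a t i) * indicator {0..h} t) \<partial>lborel)"
    by (subst nn_integral_sum) (auto simp: nn_integral_reach)
  also have "\<dots> \<le> (\<integral>\<^sup>+t. ennreal t * indicator {0..h} t \<partial>lborel)"
  proof (intro nn_integral_mono)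
    fix t :: real
    show "(\<Sum>i<n. ennreal (a t i) * indicator {0..h} t) \<le> ennreal t * indicator {0..h} t"
    proof (cases "t \<in> {0..h}")
      case True
      then have "(\<Sum>i<n. ennreal (a t i)) = ennreal (\<Sum>i<n. a t i)"
        using a_nonneg by (intro sum_ennreal) auto
      then show ?thesis
        using True a_sum_le[of t] by (auto intro: ennreal_leI)
    qed auto
  qed
  also have "\<dots> = ennreal (h\<^sup>2 / 2 - 0\<^sup>2 / 2)"
    using h_pos by (intro nn_integral_FTC_Icc) (auto intro!: derivative_eq_intros)
  finally show ?thesis
    by simp
qed

lemma sum_first_pairs_le:
  "(\<Sum>i<n. (\<Sum>j\<in>{..<n} - {i}. emeasure (lborel \<Otimes>\<^sub>M lborel) (first_pairs i j))
      + (\<integral>\<^sup>+y. ennreal (1 - y) * indicator (deep_wins i) y \<partial>lborel)) \<le> ennreal (h\<^sup>2 / 2)"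
proof -
  have "(\<Sum>j\<in>{..<n} - {i}. emeasure (lborel \<Otimes>\<^sub>M lborel) (first_pairs i j))
      + (\<integral>\<^sup>+y. ennreal (1 - y) * indicator (deep_wins i) y \<partial>lborel) \<le> (\<integral>\<^sup>+y. reach i y \<partial>lborel)"
    if "i < n" for i
  proof -
    have first: "first_pairs i j \<in> sets (lborel \<Otimes>\<^sub>M lborel)" if "j < n" for j
      using first_pairs_measurable[OF \<open>i < n\<close> that] by (simp cong: sets_pair_measure_cong)
    have slice: "(\<lambda>y. emeasure lborel (Pair y -` first_pairs i j)) \<in> borel_measurable lborel"
      if "j < n" for j
      using first[OF that] by (rule lborel.measurable_emeasure_Pair)
    have "(\<Sum>j\<in>{..<n} - {i}. emeasure (lborel \<Otimes>\<^sub>M lborel) (first_pairs i j))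
      = (\<Sum>j\<in>{..<n} - {i}. \<integral>\<^sup>+y. emeasure lborel (Pair y -` first_pairs i j) \<partial>lborel)"
      using first by (intro sum.cong refl lborel.emeasure_pair_measure_alt) auto
    also have "\<dots> = (\<integral>\<^sup>+y. (\<Sum>j\<in>{..<n} - {i}. emeasure lborel (Pair y -` first_pairs i j)) \<partial>lborel)"
      using slice by (intro nn_integral_sum[symmetric]) auto
    finally have "(\<Sum>j\<in>{..<n} - {i}. emeasure (lborel \<Otimes>\<^sub>M lborel) (first_pairs i j))
        + (\<integral>\<^sup>+y. ennreal (1 - y) * indicator (deep_wins i) y \<partial>lborel)
      = (\<integral>\<^sup>+y. (\<Sum>j\<in>{..<n} - {i}. emeasure lborel (Pair y -` first_pairs i j)) \<partial>lborel)
        + (\<integral>\<^sup>+y. ennreal (1 - y) * indicator (deep_wins i) y \<partial>lborel)"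
      by (simp only:)
    also have "\<dots>
      = (\<integral>\<^sup>+y. (\<Sum>j\<in>{..<n} - {i}. emeasure lborel (Pair y -` first_pairs i j))
          + ennreal (1 - y) * indicator (deep_wins i) y \<partial>lborel)"
      using slice by (intro nn_integral_add[symmetric] borel_measurable_sum) auto
    also have "\<dots> \<le> (\<integral>\<^sup>+y. reach i y \<partial>lborel)"
    proof (rule nn_integral_mono)
      fix y :: real
      show "(\<Sum>j\<in>{..<n} - {i}. emeasure lborel (Pair y -` first_pairs i j))
          + ennreal (1 - y) * indicator (deep_wins i) y \<le> reach i y"
        by (rule slice_bound[OF that])
    qed
    finally show ?thesis .
  qed
  then have "(\<Sum>i<n. (\<Sum>j\<in>{..<n} - {i}. emeasure (lborel \<Otimes>\<^sub>M lborel) (first_pairs i j))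
      + (\<integral>\<^sup>+y. ennreal (1 - y) * indicator (deep_wins i) y \<partial>lborel))
      \<le> (\<Sum>i<n. \<integral>\<^sup>+y. reach i y \<partial>lborel)"
    by (intro sum_mono) (simp only: lessThan_iff)
  also note sum_nn_integral_reach
  finally show ?thesis .
qed

end

subsection \<open>The random basic strategy\<close>

text \<open>Links the hider's view to the searcher's: an unordered pair of different holes splits
  into the two orders of discovery, while a repeated hole contributes one term.\<close>

lemma sum_ordered_pairs:
  fixes G :: "nat \<Rightarrow> nat \<Rightarrow> 'a::comm_monoid_add"
  shows "(\<Sum>(i, j) \<in> {(i, j). i \<le> j \<and> j < n}. if i = j then K i else G i j + G j i)
    = (\<Sum>i<n. (\<Sum>j\<in>{..<n} - {i}. G i j) + K i)"
proof -
  let ?S = "{(i, j). i < j \<and> j < n}" and ?S' = "{(i, j). j < i \<and> i < n}"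
  have fin: "finite ?S" "finite ?S'"
    by (auto intro: finite_subset[of _ "{..<n} \<times> {..<n}"])
  have "{(i, j). i \<le> j \<and> j < n} = (\<lambda>i. (i, i)) ` {..<n} \<union> ?S"
    by (auto simp: image_iff)
  then have "(\<Sum>(i, j) \<in> {(i, j). i \<le> j \<and> j < n}. if i = j then K i else G i j + G j i)
      = (\<Sum>(i, j) \<in> (\<lambda>i. (i, i)) ` {..<n} \<union> ?S. if i = j then K i else G i j + G j i)"
    by simp
  also have "\<dots> = (\<Sum>(i, j) \<in> (\<lambda>i. (i, i)) ` {..<n}. if i = j then K i else G i j + G j i)
      + (\<Sum>(i, j) \<in> ?S. if i = j then K i else G i j + G j i)"
    using fin by (intro sum.union_disjoint) auto
  also have "(\<Sum>(i, j) \<in> (\<lambda>i. (i, i)) ` {..<n}. if i = j then K i else G i j + G j i) = (\<Sum>i<n. K i)"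
    by (subst sum.reindex) (auto simp: inj_on_def)
  also have "(\<Sum>(i, j) \<in> ?S. if i = j then K i else G i j + G j i)
      = (\<Sum>(i, j) \<in> ?S. G i j) + (\<Sum>(i, j) \<in> ?S. G j i)"
    by (subst sum.distrib[symmetric]) (auto intro!: sum.cong)
  also have "(\<Sum>(i, j) \<in> ?S. G j i) = (\<Sum>(i, j) \<in> ?S'. G i j)"
    by (rule sum.reindex_bij_witness[of _ prod.swap prod.swap]) auto
  also have "(\<Sum>(i, j) \<in> ?S. G i j) + (\<Sum>(i, j) \<in> ?S'. G i j) = (\<Sum>(i, j) \<in> ?S \<union> ?S'. G i j)"
    using fin by (intro sum.union_disjoint[symmetric]) auto
  also have "?S \<union> ?S' = (SIGMA i:{..<n}. {..<n} - {i})"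
    by auto
  also have "(\<Sum>(i, j) \<in> (SIGMA i:{..<n}. {..<n} - {i}). G i j) = (\<Sum>i<n. \<Sum>j\<in>{..<n} - {i}. G i j)"
    by (simp add: sum.Sigma)
  finally show ?thesis
    by (simp add: sum.distrib add.commute)
qed

lemma finite_ordered_pairs: "finite {(i, j). i \<le> j \<and> j < (n::nat)}"
  by (auto intro: finite_subset[of _ "{..<n} \<times> {..<n}"])

lemma ordered_pairs_nonempty: "n \<ge> 1 \<Longrightarrow> {(i, j). i \<le> j \<and> j < (n::nat)} \<noteq> {}"
  by (auto intro!: exI[of _ 0])

lemma card_ordered_pairs: "real (card {(i, j). i \<le> j \<and> j < n}) = real n * (real n + 1) / 2"
proof -
  have "2 * real (card {(i, j). i \<le> j \<and> j < n}) = (\<Sum>(i, j) \<in> {(i, j). i \<le> j \<and> j < n}. 2)"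
    by (simp add: split_beta)
  \<comment> \<open>The preceding identity with \<open>G = 1\<close> and \<open>K = 2\<close> counts
    every multiset twice.\<close>
  also have "\<dots> = (\<Sum>(i, j) \<in> {(i, j). i \<le> j \<and> j < n}. if i = j then 2 else 1 + 1)"
    by (intro sum.cong) auto
  also have "\<dots> = (\<Sum>i<n. (\<Sum>j\<in>{..<n} - {i}. 1) + 2)"
    by (rule sum_ordered_pairs)
  also have "\<dots> = (\<Sum>i<n. real n + 1)"
    by (intro sum.cong) (auto simp: card_Diff_singleton)
  finally show ?thesis
    by simp
qed

section \<open>Integration over the triangle\<close>

lemma unit_triangle_measurable [measurable]: "unit_triangle \<in> sets (borel \<Otimes>\<^sub>M borel)"
proof -
  have "unit_triangle =
      {x \<in> space (borel \<Otimes>\<^sub>M borel). 0 \<le> fst x \<and> 0 \<le> snd x \<and> fst x + snd x \<le> 1}"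
    by (auto simp: unit_triangle_def space_pair_measure)
  also have "\<dots> \<in> sets (borel \<Otimes>\<^sub>M borel)"
    by measurable
  finally show ?thesis .
qed

lemma unit_triangle_borel [measurable]: "unit_triangle \<in> sets borel"
  using unit_triangle_measurable unfolding borel_prod .

text \<open>The section of the triangle above \<open>y\<close> has length \<open>1 - y\<close>; for
  \<open>y > 1\<close> the truncation in \<open>ennreal (1 - y)\<close> accounts for the empty
  section.\<close>

lemma nn_integral_triangle_fst:
  assumes [measurable]: "f \<in> borel_measurable borel"
  shows "(\<integral>\<^sup>+x. f (fst x) * indicator unit_triangle x \<partial>lborel)
    = (\<integral>\<^sup>+y. f y * ennreal (1 - y) * indicator {0..} y \<partial>lborel)"
proof -
  have "(\<integral>\<^sup>+x. f (fst x) * indicator unit_triangle x \<partial>lborel)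
      = (\<integral>\<^sup>+x. f (fst x) * indicator unit_triangle x \<partial>(lborel \<Otimes>\<^sub>M lborel))"
    by (simp add: lborel_prod)
  also have "\<dots> = (\<integral>\<^sup>+y. \<integral>\<^sup>+z. f y * indicator unit_triangle (y, z) \<partial>lborel \<partial>lborel)"
    by (subst lborel.nn_integral_fst[symmetric]) simp_all
  also have "\<dots> = (\<integral>\<^sup>+y. f y * ennreal (1 - y) * indicator {0..} y \<partial>lborel)"
  proof (intro nn_integral_cong)
    fix y :: real
    have "(\<integral>\<^sup>+z. f y * indicator unit_triangle (y, z) \<partial>lborel)
        = f y * (\<integral>\<^sup>+z. indicator unit_triangle (y, z) \<partial>lborel)"
      by (intro nn_integral_cmult) simp
    also have "(\<integral>\<^sup>+z. indicator unit_triangle (y, z) \<partial>lborel)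
        = (\<integral>\<^sup>+z. indicator {0..} y * indicator {0..1 - y} z \<partial>lborel)"
      by (intro nn_integral_cong) (auto simp: unit_triangle_def indicator_def)
    also have "\<dots> = ennreal (1 - y) * indicator {0..} y"
      by (cases "y \<le> 1") (auto simp: nn_integral_cmult ennreal_neg mult.commute)
    finally show "(\<integral>\<^sup>+z. f y * indicator unit_triangle (y, z) \<partial>lborel)
        = f y * ennreal (1 - y) * indicator {0..} y"
      by (simp add: mult.assoc)
  qed
  finally show ?thesis .
qed

lemma nn_integral_triangle_swap:
  assumes [measurable]: "f \<in> borel_measurable borel"
  shows "(\<integral>\<^sup>+x. f (prod.swap x) * indicator unit_triangle x \<partial>lborel)
    = (\<integral>\<^sup>+x. f x * indicator unit_triangle x \<partial>lborel)"
proof -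
  have f: "f \<in> borel_measurable (borel \<Otimes>\<^sub>M borel)"
    using assms unfolding borel_prod .
  have "(\<integral>\<^sup>+x. f x * indicator unit_triangle x \<partial>lborel)
      = (\<integral>\<^sup>+x. f x * indicator unit_triangle x \<partial>(lborel \<Otimes>\<^sub>M lborel))"
    by (simp add: lborel_prod)
  also have "\<dots> = (\<integral>\<^sup>+(y, z). f (z, y) * indicator unit_triangle (z, y) \<partial>(lborel \<Otimes>\<^sub>M lborel))"
    using f by (subst lborel_pair.distr_pair_swap) (simp add: nn_integral_distr split_beta)
  also have "\<dots> = (\<integral>\<^sup>+x. f (prod.swap x) * indicator unit_triangle x \<partial>(lborel \<Otimes>\<^sub>M lborel))"
    by (intro nn_integral_cong) (auto simp: unit_triangle_def indicator_def)
  finally show ?thesis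
    by (simp add: lborel_prod)
qed

lemma emeasure_unit_triangle: "emeasure lborel unit_triangle = ennreal (1 / 2)"
proof -
  have "emeasure lborel unit_triangle = (\<integral>\<^sup>+x. 1 * indicator unit_triangle x \<partial>lborel)"
    by simp
  also have "\<dots> = (\<integral>\<^sup>+y. 1 * ennreal (1 - y) * indicator {0..} y \<partial>lborel)"
    by (rule nn_integral_triangle_fst) simp
  also have "\<dots> = (\<integral>\<^sup>+y. ennreal (1 - y) * indicator {0..1} y \<partial>lborel)"
    by (intro nn_integral_cong) (auto simp: indicator_def ennreal_neg)
  also have "\<dots> = ennreal ((1 - 1\<^sup>2 / 2) - (0 - 0\<^sup>2 / 2))"
    by (intro nn_integral_FTC_Icc) (auto intro!: derivative_eq_intros)
  finally show ?thesis
    by simp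
qed

text \<open>A pmf carries the discrete sigma-algebra; pushing it to the Borel sets gives a kernel
  into one fixed space, as the bind over the triangle demands.\<close>

definition basic_kernel :: "nat \<Rightarrow> real \<times> real \<Rightarrow> placement measure" where
  "basic_kernel n = (\<lambda>(y1, y2). distr (measure_pmf (basic_strategy n y1 y2)) borel (\<lambda>x. x))"

text \<open>Twice the probability of \<open>A\<close>, given that the multiset of the holes \<open>i\<close> and \<open>j\<close> is chosen.\<close>

definition basic_weight :: "placement set \<Rightarrow> nat \<Rightarrow> nat \<Rightarrow> real \<times> real \<Rightarrow> ennreal" where
  "basic_weight A i j y =
     (if i \<noteq> j then indicator A ((i, fst y), (j, snd y)) + indicator A ((i, snd y), (j, fst y))
      else indicator A ((i, fst y), (i, 1)) + indicator A ((i, snd y), (i, 1)))"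

lemma emeasure_basic_kernel:
  assumes "n \<ge> 1" "A \<in> sets borel"
  shows "emeasure (basic_kernel n y) A =
    (\<Sum>(i, j) \<in> {(i, j). i \<le> j \<and> j < n}. basic_weight A i j y / 2) / card {(i, j). i \<le> j \<and> j < n}"
proof -
  have half: "ennreal (1 / 2) = 1 / 2"
    by (simp add: divide_ennreal_def)
  have "emeasure (basic_kernel n y) A = emeasure (basic_strategy n (fst y) (snd y)) A"
    using assms(2) by (simp add: basic_kernel_def split_beta emeasure_distr)
  also have "\<dots> = (\<Sum>(i, j) \<in> {(i, j). i \<le> j \<and> j < n}. basic_weight A i j y / 2)
      / card {(i, j). i \<le> j \<and> j < n}"
    unfolding basic_strategy_def emeasure_bind_pmf
      nn_integral_pmf_of_set[OF ordered_pairs_nonempty[OF assms(1)] finite_ordered_pairs]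
    by (intro arg_cong2[of _ _ _ _ "(/)"] sum.cong refl)
      (auto simp: basic_weight_def half add_divide_distrib_ennreal divide_ennreal_def distrib_right)
  finally show ?thesis .
qed

lemma borel_measurable_nuts:
  assumes "f \<in> borel_measurable borel" "g \<in> borel_measurable borel" "A \<in> sets borel"
  shows "(\<lambda>y. indicator A ((i::nat, f y :: real), (j::nat, g y :: real)) :: ennreal) \<in> borel_measurable borel"
proof -
  have "(\<lambda>x::real \<times> real. ((i, fst x), (j, snd x))) \<in> borel_measurable borel"
    by (intro borel_measurable_continuous_onI continuous_intros)
  then have "(\<lambda>y. ((i, fst (f y, g y)), (j, snd (f y, g y)))) \<in> borel_measurable borel"
    by (rule measurable_compose[rotated]) (intro borel_measurable_Pair assms)
  from measurable_compose[OF this borel_measurable_indicator[OF assms(3)]] show ?thesis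
    by simp
qed

lemma borel_measurable_basic_weight:
  assumes "A \<in> sets borel"
  shows "basic_weight A i j \<in> borel_measurable borel"
proof -
  have "fst \<in> borel_measurable borel" "snd \<in> borel_measurable borel"
    by (intro borel_measurable_continuous_onI continuous_intros)+
  then show ?thesis
    unfolding basic_weight_def[abs_def]
    by (cases "i = j") (auto intro!: borel_measurable_add borel_measurable_nuts[OF _ _ assms])
qed

lemma prob_space_basic_kernel: "prob_space (basic_kernel n y)"
  by (auto simp: basic_kernel_def split_beta intro!: measure_pmf.prob_space_distr)

lemma measurable_basic_kernel:
  assumes "n \<ge> 1"
  shows "basic_kernel n \<in> borel \<rightarrow>\<^sub>M prob_algebra borel"
proof (rule measurable_prob_algebraI)
  show "prob_space (basic_kernel n y)" for y
    by (rule prob_space_basic_kernel)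
  show "basic_kernel n \<in> borel \<rightarrow>\<^sub>M subprob_algebra borel"
  proof (rule measurable_subprob_algebra)
    fix y
    show "subprob_space (basic_kernel n y)"
      by (rule prob_space_imp_subprob_space[OF prob_space_basic_kernel])
    show "sets (basic_kernel n y) = sets borel"
      by (simp add: basic_kernel_def split_beta)
  next
    fix A :: "placement set" assume A: "A \<in> sets borel"
    show "(\<lambda>y. emeasure (basic_kernel n y) A) \<in> borel_measurable borel"
      unfolding emeasure_basic_kernel[OF assms A] using borel_measurable_basic_weight[OF A]
      by (auto intro!: borel_measurable_divide_ennreal borel_measurable_sum)
  qed
qed

lemma measurable_uniform_triangle:
  "uniform_measure lborel unit_triangle \<in> space (prob_algebra borel)"
  by (auto simp: space_prob_algebra emeasure_unit_triangle intro!: prob_space_uniform_measure)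

lemma uniform_basic_strategy_altdef:
  "uniform_basic_strategy n = uniform_measure lborel unit_triangle \<bind> basic_kernel n"
  by (simp add: uniform_basic_strategy_def basic_kernel_def)

lemma uniform_basic_strategy_in_prob_algebra:
  assumes "n \<ge> 1"
  shows "uniform_basic_strategy n \<in> space (prob_algebra borel)"
  unfolding uniform_basic_strategy_altdef
  using measurable_uniform_triangle measurable_basic_kernel[OF assms]
  by (auto simp: space_prob_algebra intro!: prob_space_bind' sets_bind')

text \<open>The inner \<open>/ 2\<close> is the coin that assigns the depths; the final
  \<open>ennreal (1 / 2)\<close> is the area of the triangle.\<close>

lemma emeasure_uniform_basic_strategy:
  assumes n: "n \<ge> 1" and A: "A \<in> sets borel"
  shows "emeasure (uniform_basic_strategy n) A =
    (\<Sum>(i, j) \<in> {(i, j). i \<le> j \<and> j < n}.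
      \<integral>\<^sup>+y. basic_weight A i j y / 2 * indicator unit_triangle y \<partial>lborel)
      / card {(i, j). i \<le> j \<and> j < n} / ennreal (1 / 2)"
proof -
  note [measurable] = borel_measurable_basic_weight[OF A]
  have K: "basic_kernel n \<in> uniform_measure lborel unit_triangle \<rightarrow>\<^sub>M subprob_algebra borel"
    using measurable_prob_algebraD[OF measurable_basic_kernel[OF n]] by (simp cong: measurable_cong_sets)
  have "emeasure (uniform_basic_strategy n) A =
      (\<integral>\<^sup>+y. emeasure (basic_kernel n y) A \<partial>uniform_measure lborel unit_triangle)"
    unfolding uniform_basic_strategy_altdef
    by (rule emeasure_bind[OF _ K A]) simp
  also have "\<dots> = (\<integral>\<^sup>+y. emeasure (basic_kernel n y) A * indicator unit_triangle y \<partial>lborel)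
      / ennreal (1 / 2)"
    using measurable_emeasure_kernel[OF measurable_prob_algebraD[OF measurable_basic_kernel[OF n]] A]
    by (subst nn_integral_uniform_measure) (auto simp: emeasure_unit_triangle)
  also have "(\<integral>\<^sup>+y. emeasure (basic_kernel n y) A * indicator unit_triangle y \<partial>lborel)
      = (\<integral>\<^sup>+y. (\<Sum>(i, j) \<in> {(i, j). i \<le> j \<and> j < n}. basic_weight A i j y / 2 * indicator unit_triangle y)
          / card {(i, j). i \<le> j \<and> j < n} \<partial>lborel)"
    unfolding emeasure_basic_kernel[OF n A]
    by (intro nn_integral_cong) (simp add: divide_ennreal_def sum_distrib_left sum_distrib_right split_beta mult_ac)
  also have "\<dots> = (\<integral>\<^sup>+y. (\<Sum>(i, j) \<in> {(i, j). i \<le> j \<and> j < n}. basic_weight A i j y / 2 * indicator unit_triangle y) \<partial>lborel)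
          / card {(i, j). i \<le> j \<and> j < n}"
    unfolding split_beta by (intro nn_integral_divide) measurable
  also have "(\<integral>\<^sup>+y. (\<Sum>(i, j) \<in> {(i, j). i \<le> j \<and> j < n}. basic_weight A i j y / 2 * indicator unit_triangle y) \<partial>lborel)
      = (\<Sum>(i, j) \<in> {(i, j). i \<le> j \<and> j < n}.
      \<integral>\<^sup>+y. basic_weight A i j y / 2 * indicator unit_triangle y \<partial>lborel)"
    unfolding split_beta by (intro nn_integral_sum) measurable
  finally show ?thesis .
qed

lemma sets_uniform_basic_strategy: "n \<ge> 1 \<Longrightarrow> sets (uniform_basic_strategy n) = sets borel"
  and prob_space_uniform_basic_strategy: "n \<ge> 1 \<Longrightarrow> prob_space (uniform_basic_strategy n)"
  using uniform_basic_strategy_in_prob_algebra[of n] by (simp_all add: space_prob_algebra)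

lemma measurable_placement [measurable]:
  "(\<lambda>x::placement. fst (fst x)) \<in> borel \<rightarrow>\<^sub>M count_space UNIV"
  "(\<lambda>x::placement. fst (snd x)) \<in> borel \<rightarrow>\<^sub>M count_space UNIV"
  "(\<lambda>x::placement. snd (fst x)) \<in> borel \<rightarrow>\<^sub>M borel"
  "(\<lambda>x::placement. snd (snd x)) \<in> borel \<rightarrow>\<^sub>M borel"
  by (auto simp: measurable_cong_sets[OF refl sets_borel_eq_count_space, symmetric]
      intro!: borel_measurable_continuous_onI continuous_intros)

text \<open>There are finitely many pairs of holes and hole numbers are discrete, so Borel
  measurability reduces to planar sections.\<close>

lemma sets_placement_pairs:
  assumes "\<And>i j. {y :: real \<times> real. P i j (fst y) (snd y)} \<in> sets borel"
  shows "{((i, y), (j, z)) | i j y z. i < n \<and> j < n \<and> P i j y z} \<in> sets (borel :: placement measure)"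
proof -
  have "{((i, y), (j, z)) | i j y z. i < n \<and> j < n \<and> P i j y z} =
      (\<Union>i<n. \<Union>j<n. {x :: placement. fst (fst x) = i} \<inter> {x. fst (snd x) = j} \<inter>
        (\<lambda>x. (snd (fst x), snd (snd x))) -` {y. P i j (fst y) (snd y)})"
    by auto
  moreover have "{x :: placement. fst (fst x) = i} \<in> sets borel" for i
    using measurable_sets[OF measurable_placement(1), of "{i}"] by (simp add: vimage_def)
  moreover have "{x :: placement. fst (snd x) = j} \<in> sets borel" for j
    using measurable_sets[OF measurable_placement(2), of "{j}"] by (simp add: vimage_def)
  moreover have "(\<lambda>x :: placement. (snd (fst x), snd (snd x))) -` {y. P i j (fst y) (snd y)} \<in> sets borel" for i j
    using measurable_sets[OF borel_measurable_Pair[OF measurable_placement(3,4)] assms, of i j]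
    by simp
  ultimately show ?thesis
    by (simp only:) (intro sets.finite_UN sets.Int finite_lessThan)
qed

lemma placements_borel [measurable]: "placements n \<in> sets borel"
proof -
  define P where "P = (\<lambda>(i::nat) j (y::real) z::real. 0 < y \<and> 0 < z \<and>
    (if i = j then y \<le> 1 \<and> z \<le> 1 else y + z \<le> 1))"
  have "placements n = {((i, y), (j, z)) | i j y z. i < n \<and> j < n \<and> P i j y z}"
  proof (rule set_eqI)
    fix x :: placement
    obtain i y j z where "x = ((i, y), (j, z))"
      by (metis prod.exhaust)
    then show "x \<in> placements n \<longleftrightarrow> x \<in> {((i, y), (j, z)) | i j y z. i < n \<and> j < n \<and> P i j y z}"
      by (cases "i = j") (auto simp: placements_same_iff placements_distinct_iff P_def)
  qed
  moreover have "{y :: real \<times> real. P i j (fst y) (snd y)} \<in> sets borel" for i j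
  proof -
    have "{y \<in> space (borel \<Otimes>\<^sub>M borel). P i j (fst y) (snd y)} \<in> sets (borel \<Otimes>\<^sub>M borel)"
      unfolding P_def by (cases "i = j"; simp only: if_True if_False; measurable)
    then show ?thesis
      unfolding borel_prod by simp
  qed
  ultimately show ?thesis
    using sets_placement_pairs[of P n] by simp
qed

lemma AE_uniform_basic_strategy:
  assumes n: "n \<ge> 1"
  shows "AE x in uniform_basic_strategy n. x \<in> placements n"
proof -
  have K: "basic_kernel n \<in> uniform_measure lborel unit_triangle \<rightarrow>\<^sub>M subprob_algebra borel"
    using measurable_prob_algebraD[OF measurable_basic_kernel[OF n]] by (simp cong: measurable_cong_sets)
  \<comment> \<open>Depth 0 is not allowed in a placement, so the two legs of the triangle have to
    be discarded as a null set.\<close>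
  have "AE x in lborel \<Otimes>\<^sub>M lborel. fst x \<noteq> (0::real) \<and> snd x \<noteq> (0::real)"
  proof (rule lborel_pair.AE_pair_measure)
    show "{x \<in> space (lborel \<Otimes>\<^sub>M lborel). fst x \<noteq> (0::real) \<and> snd x \<noteq> (0::real)} \<in> sets (lborel \<Otimes>\<^sub>M lborel)"
      by measurable
    show "AE y in lborel. AE z in lborel. fst (y, z) \<noteq> (0::real) \<and> snd (y, z) \<noteq> (0::real)"
      using AE_lborel_singleton[of "0::real"] by auto
  qed
  then have "AE y in lborel. fst y \<noteq> (0::real) \<and> snd y \<noteq> (0::real)"
    unfolding lborel_prod .
  then have "AE y in uniform_measure lborel unit_triangle. AE x in basic_kernel n y. x \<in> placements n"
  proof (intro AE_uniform_measureI)
    assume "AE y in lborel. fst y \<noteq> (0::real) \<and> snd y \<noteq> (0::real)"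
    then show "AE y in lborel. y \<in> unit_triangle \<longrightarrow> (AE x in basic_kernel n y. x \<in> placements n)"
    proof eventually_elim
      case (elim y)
      obtain y1 y2 where y: "y = (y1, y2)"
        by (rule prod.exhaust)
      have "x \<in> placements n" if "y \<in> unit_triangle" "x \<in> set_pmf (basic_strategy n y1 y2)" for x
      proof -
        have "0 < y1" "0 < y2" "y1 + y2 \<le> 1"
          using elim that(1) y by (auto simp: unit_triangle_def)
        then show ?thesis
          using that(2) set_pmf_of_set[OF ordered_pairs_nonempty[OF n] finite_ordered_pairs]
          by (auto simp: basic_strategy_def placements_same_iff placements_distinct_iff split: if_splits)
      qed
      then have "AE x in basic_kernel n y. x \<in> placements n" if "y \<in> unit_triangle"
        using that unfolding basic_kernel_def y prod.case
        by (subst AE_distr_iff) (simp_all add: AE_measure_pmf_iff)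
      then show ?case ..
    qed
  qed simp
  then show ?thesis
    unfolding uniform_basic_strategy_altdef by (subst AE_bind[OF K]) simp_all
qed

text \<open>The coin exchanges the two depths, and the uniform distribution on the triangle is
  invariant under that exchange; so one arrangement represents both.\<close>

lemma nn_integral_half_sum:
  assumes [measurable]: "f \<in> borel_measurable borel"
  shows "(\<integral>\<^sup>+x. (f x + f (prod.swap x)) / 2 * indicator unit_triangle x \<partial>lborel)
    = (\<integral>\<^sup>+x. f x * indicator unit_triangle x \<partial>lborel)"
proof -
  have [measurable]: "(\<lambda>x. f (prod.swap x)) \<in> borel_measurable borel"
    by (rule measurable_compose[OF borel_measurable_continuous_onI assms])
      (auto intro!: continuous_intros simp: prod.swap_def)
  have "(\<integral>\<^sup>+x. (f x + f (prod.swap x)) / 2 * indicator unit_triangle x \<partial>lborel)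
    = (\<integral>\<^sup>+x. (f x * indicator unit_triangle x + f (prod.swap x) * indicator unit_triangle x) / 2 \<partial>lborel)"
    by (intro nn_integral_cong) (auto simp: indicator_def)
  also have "\<dots> = ((\<integral>\<^sup>+x. f x * indicator unit_triangle x \<partial>lborel)
      + (\<integral>\<^sup>+x. f (prod.swap x) * indicator unit_triangle x \<partial>lborel)) / 2"
    by (subst nn_integral_divide) (simp_all add: nn_integral_add)
  also have "\<dots> = (\<integral>\<^sup>+x. f x * indicator unit_triangle x \<partial>lborel)"
    unfolding nn_integral_triangle_swap[OF assms]
    by (simp add: mult_2[symmetric] ennreal_mult_divide_eq mult.commute[of 2])
  finally show ?thesis .
qed

section \<open>The upper bound against a pure strategy\<close>

context pure_search
begin

text \<open>Remaining times are linearly ordered, so each winning pair falls under one of the two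
  orders of discovery; exchanging coordinates preserves area.\<close>

lemma emeasure_win_pairs_le:
  assumes "i < n" "j < n"
  shows "emeasure (lborel \<Otimes>\<^sub>M lborel) (win_pairs i j)
    \<le> emeasure (lborel \<Otimes>\<^sub>M lborel) (first_pairs i j) + emeasure (lborel \<Otimes>\<^sub>M lborel) (first_pairs j i)"
proof -
  have sets: "first_pairs k l \<in> sets (lborel \<Otimes>\<^sub>M lborel)" if "k < n" "l < n" for k l
    using first_pairs_measurable[OF that] by (simp cong: sets_pair_measure_cong)
  have swap_eq: "prod.swap = (\<lambda>x :: real \<times> real. (snd x, fst x))"
    by (simp add: fun_eq_iff)
  have swap: "prod.swap -` first_pairs j i \<in> sets (lborel \<Otimes>\<^sub>M lborel)"
    using measurable_sets[OF measurable_pair_swap' sets[OF assms(2,1)]]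
    by (simp add: swap_eq split_beta' space_pair_measure)
  have "emeasure (lborel \<Otimes>\<^sub>M lborel) (first_pairs j i)
      = emeasure (lborel \<Otimes>\<^sub>M lborel) (prod.swap -` first_pairs j i)"
    by (subst lborel_pair.distr_pair_swap, subst emeasure_distr[OF measurable_pair_swap' sets[OF assms(2,1)]])
      (simp add: swap_eq split_beta' space_pair_measure)
  moreover have "win_pairs i j \<subseteq> first_pairs i j \<union> prod.swap -` first_pairs j i"
  proof
    fix x assume "x \<in> win_pairs i j"
    then show "x \<in> first_pairs i j \<union> prod.swap -` first_pairs j i"
      using win_set_swap[of "(i, fst x)" "(j, snd x)" n h "(a, b)"]
      by (cases x) (auto simp: first_pairs_def win_pairs_def)
  qed
  ultimately show ?thesis
    using sets[OF assms] swap emeasure_subadditive[OF sets[OF assms] swap]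
    by (auto intro: order_trans[OF emeasure_mono])
qed

lemma basic_weight_le:
  assumes "i < n" "j < n"
  shows "(\<integral>\<^sup>+y. basic_weight (win_set n h (a, b)) i j y / 2 * indicator unit_triangle y \<partial>lborel)
    \<le> (if i = j then \<integral>\<^sup>+y. ennreal (1 - y) * indicator (deep_wins i) y \<partial>lborel
       else emeasure (lborel \<Otimes>\<^sub>M lborel) (first_pairs i j) + emeasure (lborel \<Otimes>\<^sub>M lborel) (first_pairs j i))"
proof -
  have [measurable]: "fst \<in> borel_measurable (borel :: (real \<times> real) measure)"
    "snd \<in> borel_measurable (borel :: (real \<times> real) measure)"
    by (intro borel_measurable_continuous_onI continuous_intros)+
  define f :: "real \<times> real \<Rightarrow> ennreal" where "f = (\<lambda>y. if i = j then indicator (deep_wins i) (fst y)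
    else indicator (win_pairs i j) y)"
  have [measurable]: "win_pairs i j \<in> sets borel"
    using win_pairs_measurable unfolding borel_prod .
  have [measurable]: "f \<in> borel_measurable borel"
    unfolding f_def by (cases "i = j") simp_all
  have "basic_weight (win_set n h (a, b)) i j y = f y + f (prod.swap y)" for y
    by (cases y) (auto simp: basic_weight_def f_def deep_wins_def win_pairs_def indicator_def)
  then have "(\<integral>\<^sup>+y. basic_weight (win_set n h (a, b)) i j y / 2 * indicator unit_triangle y \<partial>lborel)
      = (\<integral>\<^sup>+y. f y * indicator unit_triangle y \<partial>lborel)"
    by (simp add: nn_integral_half_sum)
  also have "\<dots> \<le> (if i = j then \<integral>\<^sup>+y. ennreal (1 - y) * indicator (deep_wins i) y \<partial>lborel
       else emeasure (lborel \<Otimes>\<^sub>M lborel) (first_pairs i j) + emeasure (lborel \<Otimes>\<^sub>M lborel) (first_pairs j i))"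
  proof (cases "i = j")
    case True
    then have "(\<integral>\<^sup>+y. f y * indicator unit_triangle y \<partial>lborel) =
        (\<integral>\<^sup>+y. indicator (deep_wins i) (fst y) * indicator unit_triangle y \<partial>lborel)"
      by (simp add: f_def)
    also have "\<dots> = (\<integral>\<^sup>+y. indicator (deep_wins i) y * ennreal (1 - y) * indicator {0..} y \<partial>lborel)"
      by (rule nn_integral_triangle_fst) simp
    also have "\<dots> \<le> (\<integral>\<^sup>+y. ennreal (1 - y) * indicator (deep_wins i) y \<partial>lborel)"
      by (intro nn_integral_mono) (auto simp: indicator_def)
    finally show ?thesis
      using True by simp
  next
    case False
    \<comment> \<open>For different holes the restriction to the triangle is simply dropped; for
      equal holes it produced the weight \<open>1 - y\<close>.\<close>
    then have "(\<integral>\<^sup>+y. f y * indicator unit_triangle y \<partial>lborel) \<le>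
        (\<integral>\<^sup>+y. indicator (win_pairs i j) y \<partial>lborel)"
      by (intro nn_integral_mono) (auto simp: f_def indicator_def)
    also have "\<dots> = emeasure (lborel \<Otimes>\<^sub>M lborel) (win_pairs i j)"
      by (simp add: lborel_prod)
    also note emeasure_win_pairs_le[OF assms]
    finally show ?thesis
      using False by simp
  qed
  finally show ?thesis .
qed

lemma measure_win_set_le:
  "measure (uniform_basic_strategy n) (win_set n h (a, b)) \<le> 2 * h\<^sup>2 / (real n * (real n + 1))"
proof (cases "n \<ge> 1")
  case True
  let ?N = "card {(i, j). i \<le> j \<and> j < n}"
  have N: "real ?N = real n * (real n + 1) / 2"
    by (rule card_ordered_pairs)
  have "0 < real n * (real n + 1) / 2"
    using True by simp
  then have N_pos: "0 < real ?N"
    by (simp only: N)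
  have "(\<Sum>(i, j) \<in> {(i, j). i \<le> j \<and> j < n}.
      \<integral>\<^sup>+y. basic_weight (win_set n h (a, b)) i j y / 2 * indicator unit_triangle y \<partial>lborel)
    \<le> (\<Sum>(i, j) \<in> {(i, j). i \<le> j \<and> j < n}.
      if i = j then \<integral>\<^sup>+y. ennreal (1 - y) * indicator (deep_wins i) y \<partial>lborel
      else emeasure (lborel \<Otimes>\<^sub>M lborel) (first_pairs i j) + emeasure (lborel \<Otimes>\<^sub>M lborel) (first_pairs j i))"
    unfolding split_beta by (intro sum_mono basic_weight_le) auto
  also have "\<dots> = (\<Sum>i<n. (\<Sum>j\<in>{..<n} - {i}. emeasure (lborel \<Otimes>\<^sub>M lborel) (first_pairs i j))
      + (\<integral>\<^sup>+y. ennreal (1 - y) * indicator (deep_wins i) y \<partial>lborel))"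
    by (rule sum_ordered_pairs)
  also note sum_first_pairs_le
  finally have "emeasure (uniform_basic_strategy n) (win_set n h (a, b))
      \<le> ennreal (h\<^sup>2 / 2) / ?N / ennreal (1 / 2)"
    unfolding emeasure_uniform_basic_strategy[OF True win_set_borel]
    by (intro divide_right_mono_ennreal)
  also have "\<dots> = ennreal (h\<^sup>2 / 2 / real ?N / (1 / 2))"
    using divide_ennreal[of "h\<^sup>2 / 2" "real ?N"] divide_ennreal[of "h\<^sup>2 / 2 / real ?N" "1 / 2"] N_pos
    by (simp only: ennreal_of_nat_eq_real_of_nat) (simp del: ennreal_half)
  also have "h\<^sup>2 / 2 / real ?N / (1 / 2) = 2 * h\<^sup>2 / (real n * (real n + 1))"
    unfolding N using True by (simp add: field_simps)
  finally show ?thesis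
    using True by (simp add: measure_def enn2real_leI)
next
  case False
  \<comment> \<open>Without holes there are no placements, and the right side is 0 by division by
    zero.\<close>
  then have "win_set n h (a, b) = {}"
    by (auto simp: win_set_def placements_def)
  then show ?thesis
    by simp
qed

end

subsection \<open>The parallel search\<close>

lemma permutes_compose_inj_on:
  assumes "\<tau> permutes S"
  shows "inj_on ((\<circ>) \<tau>) X"
  using permutes_inj[OF assms] by (auto simp: inj_on_def fun_eq_iff)

text \<open>Composing with a transposition maps the permutations with one value at \<open>x\<close>
  injectively to those with another. The fibres are therefore equally large, and together they
  exhaust all permutations.\<close>

lemma card_permutations_point:
  assumes S: "finite S" and "x \<in> S" "a \<in> S"
  shows "card S * card {\<pi>. \<pi> permutes S \<and> \<pi> x = a} = fact (card S)"
proof -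
  let ?M = "\<lambda>a. {\<pi>. \<pi> permutes S \<and> \<pi> x = a}"
  have fin: "finite (?M a)" for a
    using finite_permutations[OF S] by (rule rev_finite_subset) auto
  have le: "card (?M b) \<le> card (?M c)" if "b \<in> S" "c \<in> S" for b c
  proof (rule card_inj_on_le)
    have \<tau>: "Transposition.transpose b c permutes S"
      using that by (rule permutes_swap_id)
    show "inj_on ((\<circ>) (Transposition.transpose b c)) (?M b)"
      by (rule permutes_compose_inj_on[OF \<tau>])
    show "(\<circ>) (Transposition.transpose b c) ` ?M b \<subseteq> ?M c"
      using permutes_compose[OF _ \<tau>] by auto
  qed (rule fin)
  have "card (?M b) = card (?M a)" if "b \<in> S" for b
    using le[OF that \<open>a \<in> S\<close>] le[OF \<open>a \<in> S\<close> that] by simp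
  then have "card S * card (?M a) = (\<Sum>b\<in>S. card (?M b))"
    by simp
  also have "\<dots> = card (\<Union>b\<in>S. ?M b)"
    using S fin by (intro card_UN_disjoint[symmetric]) auto
  also have "(\<Union>b\<in>S. ?M b) = {\<pi>. \<pi> permutes S}"
    using permutes_in_image[of _ S x] \<open>x \<in> S\<close> by auto
  finally show ?thesis
    using card_permutations[OF refl S] by simp
qed

lemma card_permutations_pair:
  assumes S: "finite S" and xy: "x \<in> S" "y \<in> S" "x \<noteq> y" and ab: "a \<in> S" "b \<in> S" "a \<noteq> b"
  shows "card S * (card S - 1) * card {\<pi>. \<pi> permutes S \<and> \<pi> x = a \<and> \<pi> y = b} = fact (card S)"
proof -
  let ?M = "\<lambda>p. {\<pi>. \<pi> permutes S \<and> \<pi> x = fst p \<and> \<pi> y = snd p}"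
  let ?D = "SIGMA a:S. S - {a}"
  have fin: "finite (?M p)" for p
    using finite_permutations[OF S] by (rule rev_finite_subset) auto
  have le: "card (?M p) \<le> card (?M q)" if "p \<in> ?D" "q \<in> ?D" for p q
  proof -
    obtain a b c d where pq: "p = (a, b)" "q = (c, d)"
      by (metis prod.exhaust)
    \<comment> \<open>The inner transposition sends \<open>a\<close> to \<open>c\<close>; the outer
      one sends the image of \<open>b\<close> to \<open>d\<close>. It fixes \<open>c\<close>, since
      neither that image nor \<open>d\<close> equals \<open>c\<close>.\<close>
    define \<tau> where "\<tau> = Transposition.transpose (Transposition.transpose a c b) d \<circ> Transposition.transpose a c"
    have S: "a \<in> S" "b \<in> S" "c \<in> S" "d \<in> S" "a \<noteq> b" "c \<noteq> d"
      using that pq by auto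
    then have "Transposition.transpose a c b \<in> S"
      by (auto simp: Transposition.transpose_def)
    then have \<tau>: "\<tau> permutes S"
      unfolding \<tau>_def using S by (intro permutes_compose permutes_swap_id)
    have "\<tau> a = c" "\<tau> b = d"
      using S by (auto simp: \<tau>_def Transposition.transpose_def)
    then have "(\<circ>) \<tau> ` ?M p \<subseteq> ?M q"
      using permutes_compose[OF _ \<tau>] by (auto simp: pq)
    then show ?thesis
      by (rule card_inj_on_le[OF permutes_compose_inj_on[OF \<tau>] _ fin])
  qed
  have D: "(a, b) \<in> ?D"
    using ab by auto
  have "card (?M p) = card (?M (a, b))" if "p \<in> ?D" for p
    using le[OF that D] le[OF D that] by (rule antisym)
  then have "(\<Sum>p\<in>?D. card (?M p)) = (\<Sum>p\<in>?D. card (?M (a, b)))"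
    by (rule sum.cong[OF refl])
  then have "card ?D * card (?M (a, b)) = (\<Sum>p\<in>?D. card (?M p))"
    by (simp only: sum_constant of_nat_id)
  also have "\<dots> = card (\<Union>p\<in>?D. ?M p)"
    using S fin by (intro card_UN_disjoint[symmetric]) (simp, blast, force)
  also have "(\<Union>p\<in>?D. ?M p) = {\<pi>. \<pi> permutes S}"
  proof (intro set_eqI iffI)
    fix \<pi> assume "\<pi> \<in> {\<pi>. \<pi> permutes S}"
    then have \<pi>: "\<pi> permutes S" by simp
    then have "(\<pi> x, \<pi> y) \<in> ?D"
      using xy permutes_in_image[OF \<pi>] inj_eq[OF permutes_inj[OF \<pi>], of x y] by simp
    with \<pi> show "\<pi> \<in> (\<Union>p\<in>?D. ?M p)"
      by (intro UN_I[of "(\<pi> x, \<pi> y)"]) simp_all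
  qed auto
  also have "card ?D = card S * (card S - 1)"
    using S by (simp add: card_Diff_singleton)
  finally show ?thesis
    using card_permutations[OF refl S] by simp
qed

lemma permutations_lessThan:
  "{\<pi>. \<pi> permutes {..<n::nat}} \<noteq> {}" "finite {\<pi>. \<pi> permutes {..<n::nat}}"
  using finite_permutations[of "{..<n}"] by (auto intro: permutes_id)

lemma prob_permutation_point:
  fixes n :: nat
  assumes "x < n" "I \<subseteq> {..<n}"
  shows "measure_pmf.prob (pmf_of_set {\<pi>. \<pi> permutes {..<n}}) {\<pi>. \<pi> x \<in> I} = real (card I) / real n"
proof -
  let ?P = "{\<pi>. \<pi> permutes {..<n}}"
  have I: "finite I"
    using assms(2) by (rule finite_subset) simp
  note P = permutations_lessThan[of n]
  have card_P: "card ?P = fact n"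
    using card_permutations[of "{..<n}" n] by simp
  have "card (?P \<inter> {\<pi>. \<pi> x \<in> I}) = card (\<Union>a\<in>I. {\<pi>. \<pi> permutes {..<n} \<and> \<pi> x = a})"
    by (rule arg_cong[of _ _ card]) auto
  also have "\<dots> = (\<Sum>a\<in>I. card {\<pi>. \<pi> permutes {..<n} \<and> \<pi> x = a})"
    using I P(2) by (intro card_UN_disjoint) (auto intro: rev_finite_subset)
  finally have "n * card (?P \<inter> {\<pi>. \<pi> x \<in> I}) = (\<Sum>a\<in>I. n * card {\<pi>. \<pi> permutes {..<n} \<and> \<pi> x = a})"
    by (simp add: sum_distrib_left)
  also have "\<dots> = (\<Sum>a\<in>I. fact n)"
    using assms card_permutations_point[of "{..<n}" x] by (intro sum.cong) auto
  finally have "n * card (?P \<inter> {\<pi>. \<pi> x \<in> I}) = card I * fact n"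
    by simp
  then have "real n * real (card (?P \<inter> {\<pi>. \<pi> x \<in> I})) = real (card I) * fact n"
    by (metis of_nat_mult of_nat_fact)
  then show ?thesis
    using assms(1) by (simp add: measure_pmf_of_set[OF P] card_P field_simps)
qed

lemma prob_permutation_pair:
  fixes n :: nat
  assumes xy: "x < n" "y < n" "x \<noteq> y" and IJ: "I \<subseteq> {..<n}" "J \<subseteq> {..<n}" "I \<inter> J = {}"
  shows "measure_pmf.prob (pmf_of_set {\<pi>. \<pi> permutes {..<n}}) {\<pi>. \<pi> x \<in> I \<and> \<pi> y \<in> J}
    = real (card I) * real (card J) / (real n * (real n - 1))"
proof -
  let ?P = "{\<pi>. \<pi> permutes {..<n}}"
  let ?M = "\<lambda>p. {\<pi>. \<pi> permutes {..<n} \<and> \<pi> x = fst p \<and> \<pi> y = snd p}"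
  have fin: "finite (I \<times> J)"
    using IJ by (meson finite_SigmaI finite_lessThan finite_subset)
  note P = permutations_lessThan[of n]
  have card_P: "card ?P = fact n"
    using card_permutations[of "{..<n}" n] by simp
  have "card (?P \<inter> {\<pi>. \<pi> x \<in> I \<and> \<pi> y \<in> J}) = card (\<Union>p\<in>I \<times> J. ?M p)"
    by (rule arg_cong[of _ _ card]) auto
  also have "\<dots> = (\<Sum>p\<in>I \<times> J. card (?M p))"
    using fin P(2) by (intro card_UN_disjoint) (auto intro: rev_finite_subset)
  finally have "n * (n - 1) * card (?P \<inter> {\<pi>. \<pi> x \<in> I \<and> \<pi> y \<in> J})
      = (\<Sum>p\<in>I \<times> J. n * (n - 1) * card (?M p))"
    by (simp add: sum_distrib_left)
  also have "\<dots> = (\<Sum>p\<in>I \<times> J. fact n)"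
  proof (rule sum.cong[OF refl])
    fix p assume "p \<in> I \<times> J"
    then show "n * (n - 1) * card (?M p) = fact n"
      using xy IJ card_permutations_pair[of "{..<n}" x y "fst p" "snd p"] by fastforce
  qed
  finally have "n * (n - 1) * card (?P \<inter> {\<pi>. \<pi> x \<in> I \<and> \<pi> y \<in> J}) = card I * card J * fact n"
    by (simp add: card_cartesian_product)
  then have "real n * real (n - 1) * real (card (?P \<inter> {\<pi>. \<pi> x \<in> I \<and> \<pi> y \<in> J}))
      = real (card I) * real (card J) * fact n"
    by (simp only: of_nat_mult[symmetric] of_nat_fact[symmetric, where 'a = real])
  moreover have "real (n - 1) = real n - 1" "1 < n"
    using xy by (auto simp: of_nat_diff)
  ultimately show ?thesis
    by (simp add: measure_pmf_of_set[OF P] card_P field_simps)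
qed

text \<open>
  The permutation \<open>\<pi>\<close> ranks the holes. Those of rank below \<open>m\<close> are dug at equal speed until the first
  nut is found, at depth \<open>y\<close>, say. The remaining digging \<open>m * (1 - y)\<close> is exactly enough to search \<open>m\<close>
  holes for the second nut: the holes of the next \<open>m\<close> ranks, or, if \<open>c\<close> holds, those of the next
  \<open>m - 1\<close> ranks and the hole of the first nut.
\<close>

definition parallel_path :: "nat \<Rightarrow> (nat \<Rightarrow> nat) \<Rightarrow> path" where
  "parallel_path m \<pi> t i = (if \<pi> i < m then t / m else 0)"

definition second_targets :: "nat \<Rightarrow> bool \<Rightarrow> (nat \<Rightarrow> nat) \<Rightarrow> nat \<Rightarrow> nat set" where
  "second_targets m c \<pi> i = {j. \<pi> j \<in> {m..<(if c then 2 * m - 1 else 2 * m)} \<or> c \<and> j = i}"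

definition parallel_search :: "nat \<Rightarrow> bool \<Rightarrow> (nat \<Rightarrow> nat) \<Rightarrow> strategy" where
  "parallel_search m c \<pi> = (parallel_path m \<pi>, \<lambda>t i v j.
     parallel_path m \<pi> t j + (if j \<in> second_targets m c \<pi> i then (v - t) / m else 0))"

lemma card_rank_less:
  assumes "\<pi> permutes {..<n}" "finite R"
  shows "card {j \<in> {..<n}. \<pi> j \<in> R} \<le> card R"
  using permutes_inj[OF assms(1)] assms(2)
  by (intro card_inj_on_le[of \<pi>]) (auto simp: inj_on_def)

lemma digging_parallel:
  assumes "m \<ge> 1" "card {j \<in> {..<n}. j \<in> R} \<le> m"
    and p: "\<And>u v j. s \<le> u \<Longrightarrow> u \<le> v \<Longrightarrow> v \<le> t \<Longrightarrow> j < n \<Longrightarrow> p v j - p u j = (if j \<in> R then (v - u) / m else 0)"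
  shows "digging n s t p"
  unfolding digging_def
proof (intro allI impI conjI)
  fix u v i assume uv: "s \<le> u" "u \<le> v" "v \<le> t"
  have "(\<Sum>i<n. p v i - p u i) = (\<Sum>j<n. if j \<in> R then (v - u) / m else 0)"
    using p[OF uv] by (intro sum.cong) auto
  also have "\<dots> = card {j \<in> {..<n}. j \<in> R} * ((v - u) / m)"
    by (subst sum.inter_filter[symmetric]) auto
  also have "\<dots> \<le> m * ((v - u) / m)"
    using assms(2) uv by (intro mult_right_mono) auto
  also have "\<dots> = v - u"
    using assms(1) by simp
  finally show "(\<Sum>i<n. p v i - p u i) \<le> v - u" .
  assume "i < n"
  from p[OF uv this] have "0 \<le> p v i - p u i"
    using uv by (auto split: if_splits)
  then show "p u i \<le> p v i" by simp
qed

lemma found_at_parallel_path: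
  assumes "m \<ge> 1" "0 < y" "0 \<le> t"
  shows "found_at (parallel_path m \<pi>) (i, y) t \<longleftrightarrow> \<pi> i < m \<and> t = m * y"
proof (cases "\<pi> i < m")
  case True
  have "t = m * y" if "y \<le> t / m" and *: "\<And>s. 0 \<le> s \<Longrightarrow> s < t \<Longrightarrow> s / m < y"
  proof (rule ccontr)
    assume "t \<noteq> m * y"
    then show False
      using that(1) *[of "m * y"] assms by (auto simp: field_simps)
  qed
  then show ?thesis
    using True assms by (auto simp: found_at_def parallel_path_def field_simps)
next
  case False
  then show ?thesis
    using assms by (auto simp: found_at_def parallel_path_def)
qed

text \<open>The winning condition with time eliminated: the first nut turns up at time
  \<open>m * y\<close>, so the horizon becomes \<open>y \<le> 1\<close>. In this form it is visibly
  Borel in the two depths.\<close>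

definition parallel_finds :: "nat \<Rightarrow> bool \<Rightarrow> (nat \<Rightarrow> nat) \<Rightarrow> nat \<Rightarrow> nat \<Rightarrow> real \<Rightarrow> real \<Rightarrow> bool" where
  "parallel_finds m c \<pi> i j y z \<longleftrightarrow> \<pi> i < m \<and> y \<le> 1 \<and>
     (\<pi> j < m \<and> z = y \<or>
      (if \<pi> j < m then y else 0) < z \<and>
      z \<le> (if \<pi> j < m then y else 0) + (if j \<in> second_targets m c \<pi> i then 1 - y else 0))"

lemma wins_parallel_search_iff:
  assumes m: "m \<ge> 1" and yz: "0 < y" "0 < z"
  shows "wins (real m) (parallel_search m c \<pi>) ((i, y), (j, z)) \<longleftrightarrow>
    parallel_finds m c \<pi> i j y z \<or> parallel_finds m c \<pi> j i z y"
proof -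
  let ?a = "parallel_path m \<pi>"
  let ?b = "\<lambda>t i v j. ?a t j + (if j \<in> second_targets m c \<pi> i then (v - t) / m else 0)"
  have *: "(\<exists>t\<in>{0..real m}. found_at ?a (k, u) t \<and> (found_at ?a (l, v) t \<or>
      ?a t l < v \<and> v \<le> ?b t k m l)) \<longleftrightarrow> parallel_finds m c \<pi> k l u v" (is "?L \<longleftrightarrow> ?R")
    if "0 < u" "0 < v" for k l u v
  proof -
    have eq: "?a (m * u) l = (if \<pi> l < m then u else 0)" "(real m - m * u) / m = 1 - u"
      using m by (auto simp: parallel_path_def field_simps)
    have range: "real m * u \<in> {0..real m} \<longleftrightarrow> u \<le> 1"
      using m that by auto
    have "?L \<longleftrightarrow> \<pi> k < m \<and> u \<le> 1 \<and> (found_at ?a (l, v) (m * u) \<or>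
      ?a (m * u) l < v \<and> v \<le> ?b (m * u) k m l)"
      using found_at_parallel_path[OF m that(1)] range by (metis atLeastAtMost_iff)
    also have "\<dots> \<longleftrightarrow> ?R"
      unfolding parallel_finds_def eq
      using found_at_parallel_path[OF m that(2), of "m * u" \<pi> l] m that by auto
    finally show ?thesis .
  qed
  have "wins (real m) (parallel_search m c \<pi>) ((i, y), (j, z)) \<longleftrightarrow>
    (\<exists>t\<in>{0..real m}. found_at ?a (i, y) t \<and> (found_at ?a (j, z) t \<or> ?a t j < z \<and> z \<le> ?b t i m j)) \<or>
    (\<exists>t\<in>{0..real m}. found_at ?a (j, z) t \<and> (found_at ?a (i, y) t \<or> ?a t i < y \<and> y \<le> ?b t j m i))"
    unfolding parallel_search_def wins_iff fst_conv snd_conv ..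
  then show ?thesis
    unfolding *[OF yz] *[OF yz(2,1)] .
qed

lemma win_set_parallel_search_borel:
  assumes m: "m \<ge> 1"
  shows "win_set n (real m) (parallel_search m c \<pi>) \<in> sets borel"
proof -
  let ?P = "\<lambda>i j y z. parallel_finds m c \<pi> i j y z \<or> parallel_finds m c \<pi> j i z y"
  have "win_set n (real m) (parallel_search m c \<pi>) =
      placements n \<inter> {((i, y), (j, z)) | i j y z. i < n \<and> j < n \<and> ?P i j y z}"
  proof (rule set_eqI)
    fix x :: placement
    obtain i y j z where x: "x = ((i, y), (j, z))"
      by (metis prod.exhaust)
    show "x \<in> win_set n (real m) (parallel_search m c \<pi>) \<longleftrightarrow>
        x \<in> placements n \<inter> {((i, y), (j, z)) | i j y z. i < n \<and> j < n \<and> ?P i j y z}"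
      using placements_pos[of i y j z n] wins_parallel_search_iff[OF m, of y z c \<pi> i j]
      by (auto simp: win_set_def x)
  qed
  moreover have "{y :: real \<times> real. ?P i j (fst y) (snd y)} \<in> sets borel" for i j
  proof -
    have [measurable]: "Measurable.pred (borel \<Otimes>\<^sub>M borel) (\<lambda>x. parallel_finds m c \<pi> i j (fst x) (snd x))"
      "Measurable.pred (borel \<Otimes>\<^sub>M borel) (\<lambda>x. parallel_finds m c \<pi> i j (snd x) (fst x))" for i j
      unfolding parallel_finds_def
      by (cases "\<pi> i < m"; cases "\<pi> j < m"; cases "j \<in> second_targets m c \<pi> i"; simp)+
    have "{y \<in> space (borel \<Otimes>\<^sub>M borel). ?P i j (fst y) (snd y)} \<in> sets (borel \<Otimes>\<^sub>M borel)"
      by measurable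
    then show ?thesis
      unfolding borel_prod by simp
  qed
  then have "{((i, y), (j, z)) | i j y z. i < n \<and> j < n \<and> ?P i j y z} \<in> sets (borel :: placement measure)"
    by (rule sets_placement_pairs)
  ultimately show ?thesis
    using placements_borel by simp
qed

lemma parallel_search_pure:
  assumes m: "m \<ge> 1" and \<pi>: "\<pi> permutes {..<n}"
  shows "parallel_search m c \<pi> \<in> pure_strategies n (real m)"
proof -
  let ?a = "parallel_path m \<pi>"
  let ?b = "\<lambda>t i v j. ?a t j + (if j \<in> second_targets m c \<pi> i then (v - t) / m else 0)"
  have "card {j \<in> {..<n}. j \<in> {j. \<pi> j < m}} \<le> m"
    using card_rank_less[OF \<pi>, of "{..<m}"] by simp
  then have "digging n 0 (real m) ?a"
    by (rule digging_parallel[OF m]) (auto simp: parallel_path_def diff_divide_distrib)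
  moreover have "digging n t (real m) (?b t i)" for t i
  proof (rule digging_parallel[OF m])
    let ?T = "{m..<(if c then 2 * m - 1 else 2 * m)}"
    have "card {j \<in> {..<n}. j \<in> second_targets m c \<pi> i}
        \<le> card ({j \<in> {..<n}. \<pi> j \<in> ?T} \<union> (if c then {i} else {}))"
      by (intro card_mono) (auto simp: second_targets_def)
    also have "\<dots> \<le> card {j \<in> {..<n}. \<pi> j \<in> ?T} + card (if c then {i} else {})"
      by (rule card_Un_le)
    also have "\<dots> \<le> card ?T + card (if c then {i} else {})"
      by (intro add_right_mono card_rank_less[OF \<pi>]) simp
    also have "\<dots> \<le> m"
      using m by auto
    finally show "card {j \<in> {..<n}. j \<in> second_targets m c \<pi> i} \<le> m" .
  qed (auto simp: diff_divide_distrib)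
  ultimately show ?thesis
    using win_set_parallel_search_borel[OF m, of n c \<pi>]
    by (auto simp: pure_strategies_def parallel_search_def parallel_path_def)
qed

text \<open>
  The probability \<open>2 * m / (n + 1)\<close> of searching the hole of the first nut again makes the searcher
  win equally often against two nuts in the same hole and against two nuts in different holes.
\<close>

definition search_pmf :: "nat \<Rightarrow> nat \<Rightarrow> strategy pmf" where
  "search_pmf n m = bind_pmf (bernoulli_pmf (2 * real m / (real n + 1))) (\<lambda>c.
     map_pmf (parallel_search m c) (pmf_of_set {\<pi>. \<pi> permutes {..<n}}))"

lemma set_search_pmf:
  "set_pmf (search_pmf n m) \<subseteq> (\<Union>c. parallel_search m c ` {\<pi>. \<pi> permutes {..<n}})"
  using set_pmf_of_set[OF permutations_lessThan[of n]] by (auto simp: search_pmf_def)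

text \<open>A pmf lives on all strategies, but the space of a mixed strategy has to consist of pure
  ones; hence the restriction to the support.\<close>

definition search_measure :: "nat \<Rightarrow> nat \<Rightarrow> strategy measure" where
  "search_measure n m = restrict_space (measure_pmf (search_pmf n m)) (set_pmf (search_pmf n m))"

lemma search_measure_strategy:
  assumes m: "m \<ge> 1"
  shows "search_measure n m \<in> search_strategies n (real m)"
proof -
  let ?S = "set_pmf (search_pmf n m)"
  have pure: "?S \<subseteq> pure_strategies n (real m)"
    using set_search_pmf[of n m] parallel_search_pure[OF m] by auto
  have fin: "finite ?S"
    using permutations_lessThan(2)[of n] by (intro finite_subset[OF set_search_pmf] finite_UN_I) auto
  have "prob_space (search_measure n m)"
    unfolding search_measure_def
    by (intro prob_space_restrict_space measure_pmf.emeasure_eq_1_AE) (auto simp: AE_measure_pmf_iff)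
  moreover have "(SIGMA s:?S. win_set n (real m) s) \<in> sets (search_measure n m \<Otimes>\<^sub>M borel)"
  proof -
    \<comment> \<open>The support is finite and its singletons are measurable, so the win event is a
      finite union of measurable rectangles.\<close>
    have "{s} \<times> win_set n (real m) s \<in> sets (search_measure n m \<Otimes>\<^sub>M borel)" if "s \<in> ?S" for s
      using that pure by (intro pair_measureI) (auto simp: search_measure_def sets_restrict_space pure_strategies_def)
    then have "(\<Union>s\<in>?S. {s} \<times> win_set n (real m) s) \<in> sets (search_measure n m \<Otimes>\<^sub>M borel)"
      using fin by (intro sets.finite_UN) auto
    then show ?thesis
      by (simp add: Sigma_def)
  qed
  ultimately show ?thesis
    using pure by (simp add: search_strategies_def search_measure_def space_restrict_space)
qed

lemma measure_search_measure:
  assumes "m \<ge> 1" "2 * real m \<le> real n + 1"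
  shows "measure (search_measure n m) {s \<in> space (search_measure n m). wins (real m) s x} =
    2 * real m / (real n + 1) *
      measure_pmf.prob (pmf_of_set {\<pi>. \<pi> permutes {..<n}}) {\<pi>. wins (real m) (parallel_search m True \<pi>) x}
    + (1 - 2 * real m / (real n + 1)) *
      measure_pmf.prob (pmf_of_set {\<pi>. \<pi> permutes {..<n}}) {\<pi>. wins (real m) (parallel_search m False \<pi>) x}"
proof -
  let ?Q = "pmf_of_set {\<pi>. \<pi> permutes {..<n}}"
  let ?r = "2 * real m / (real n + 1)"
  let ?p = "\<lambda>c. measure_pmf.prob ?Q {\<pi>. wins (real m) (parallel_search m c \<pi>) x}"
  have r: "0 \<le> ?r" "?r \<le> 1"
    using assms by auto
  have "measure (search_measure n m) {s \<in> space (search_measure n m). wins (real m) s x}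
      = measure_pmf.prob (search_pmf n m) {s \<in> set_pmf (search_pmf n m). wins (real m) s x}"
    unfolding search_measure_def by (subst measure_restrict_space) (auto simp: space_restrict_space)
  also have "\<dots> = measure_pmf.prob (search_pmf n m) {s. wins (real m) s x}"
    by (intro measure_pmf.finite_measure_eq_AE) (auto simp: AE_measure_pmf_iff)
  finally have eq: "measure (search_measure n m) {s \<in> space (search_measure n m). wins (real m) s x}
      = measure_pmf.prob (search_pmf n m) {s. wins (real m) s x}" .
  have "emeasure (search_pmf n m) {s. wins (real m) s x} = ennreal (?p True) * ennreal ?r + ennreal (?p False) * ennreal (1 - ?r)"
    using r unfolding search_pmf_def emeasure_bind_pmf
    by (subst nn_integral_bernoulli_pmf)
      (auto simp: vimage_def measure_pmf.emeasure_eq_measure add.commute[of 1])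
  also have "\<dots> = ennreal (?r * ?p True) + ennreal ((1 - ?r) * ?p False)"
    using r by (simp only: ennreal_mult measure_nonneg diff_ge_0_iff_ge mult.commute)
  also have "\<dots> = ennreal (?r * ?p True + (1 - ?r) * ?p False)"
    using r by (intro ennreal_plus[symmetric] mult_nonneg_nonneg) auto
  finally have "measure_pmf.prob (search_pmf n m) {s. wins (real m) s x} = ?r * ?p True + (1 - ?r) * ?p False"
    unfolding measure_pmf.emeasure_eq_measure
    using r by (subst (asm) ennreal_inj) (auto intro!: add_nonneg_nonneg mult_nonneg_nonneg)
  then show ?thesis
    unfolding eq .
qed

section \<open>Winning probability of the parallel search\<close>

lemma wins_parallel_search_same:
  assumes m: "m \<ge> 1" and x: "((i, y), (i, z)) \<in> placements n" and "\<pi> i < m"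
  shows "wins (real m) (parallel_search m True \<pi>) ((i, y), (i, z))"
proof -
  have "0 < y" "0 < z" "y \<le> 1" "z \<le> 1"
    using x by (auto simp: placements_same_iff)
  then show ?thesis
    using assms(3) by (subst wins_parallel_search_iff[OF m]) (auto simp: parallel_finds_def second_targets_def)
qed

text \<open>The hole \<open>j\<close> is untouched when the first nut is found at depth
  \<open>y\<close>, and is then dug to depth \<open>1 - y\<close>, which is at least
  \<open>z\<close>.\<close>

lemma wins_parallel_search_distinct:
  assumes m: "m \<ge> 1" and x: "((i, y), (j, z)) \<in> placements n" and ij: "i \<noteq> j"
    and \<pi>: "\<pi> i < m" "\<pi> j \<in> {m..<(if c then 2 * m - 1 else 2 * m)}"
  shows "wins (real m) (parallel_search m c \<pi>) ((i, y), (j, z))"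
    and "wins (real m) (parallel_search m c \<pi>) ((j, z), (i, y))"
proof -
  have yz: "0 < y" "0 < z" "y + z \<le> 1"
    using x ij by (auto simp: placements_distinct_iff)
  then have "parallel_finds m c \<pi> i j y z"
    using \<pi> by (auto simp: parallel_finds_def second_targets_def)
  then show "wins (real m) (parallel_search m c \<pi>) ((i, y), (j, z))"
    and "wins (real m) (parallel_search m c \<pi>) ((j, z), (i, y))"
    using yz by (simp_all add: wins_parallel_search_iff[OF m])
qed

lemma prob_wins_same:
  assumes m: "1 \<le> m" "m \<le> n" and x: "((i, y), (i, z)) \<in> placements n"
  shows "real m / real n \<le> measure_pmf.prob (pmf_of_set {\<pi>. \<pi> permutes {..<n}})
    {\<pi>. wins (real m) (parallel_search m True \<pi>) ((i, y), (i, z))}"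
proof -
  have "i < n"
    using x by (rule placements_pos)
  then have "real m / real n = measure_pmf.prob (pmf_of_set {\<pi>. \<pi> permutes {..<n}}) {\<pi>. \<pi> i \<in> {..<m}}"
    using m by (subst prob_permutation_point) auto
  also have "\<dots> \<le> measure_pmf.prob (pmf_of_set {\<pi>. \<pi> permutes {..<n}})
      {\<pi>. wins (real m) (parallel_search m True \<pi>) ((i, y), (i, z))}"
    using wins_parallel_search_same[OF m(1) x] by (intro measure_pmf.finite_measure_mono) auto
  finally show ?thesis .
qed

text \<open>\<open>k\<close> is the number of fresh holes dug in the second phase. The factor 2
  comes from two disjoint events: either of the two holes may be the one dug in the first
  phase.\<close>

lemma prob_wins_distinct:
  fixes c :: bool and m n :: nat
  defines "k \<equiv> if c then m - 1 else m"
  assumes m: "1 \<le> m" "m + k \<le> n" and x: "((i, y), (j, z)) \<in> placements n" and ij: "i \<noteq> j"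
  shows "2 * real m * real k / (real n * (real n - 1)) \<le> measure_pmf.prob (pmf_of_set {\<pi>. \<pi> permutes {..<n}})
    {\<pi>. wins (real m) (parallel_search m c \<pi>) ((i, y), (j, z))}"
proof -
  let ?Q = "pmf_of_set {\<pi>. \<pi> permutes {..<n}}"
  let ?E = "\<lambda>i j. {\<pi>. \<pi> i \<in> {..<m} \<and> \<pi> j \<in> {m..<m + k}}"
  have lt: "i < n" "j < n"
    using placements_pos[OF x] by auto
  have E: "measure_pmf.prob ?Q (?E i j) = real m * real k / (real n * (real n - 1))"
    if "i < n" "j < n" "i \<noteq> j" for i j
    using that m by (subst prob_permutation_pair) auto
  have T: "{m..<(if c then 2 * m - 1 else 2 * m)} = {m..<m + k}"
    using m by (auto simp: k_def)
  have x': "((j, z), (i, y)) \<in> placements n"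
    using x ij by (auto simp: placements_distinct_iff)
  have "2 * real m * real k / (real n * (real n - 1)) = measure_pmf.prob ?Q (?E i j) + measure_pmf.prob ?Q (?E j i)"
    using E[OF lt ij] E[OF lt(2,1)] ij by simp
  also have "\<dots> = measure_pmf.prob ?Q (?E i j \<union> ?E j i)"
    by (intro measure_pmf.finite_measure_Union[symmetric]) auto
  also have "\<dots> \<le> measure_pmf.prob ?Q {\<pi>. wins (real m) (parallel_search m c \<pi>) ((i, y), (j, z))}"
  proof (intro measure_pmf.finite_measure_mono subsetI)
    fix \<pi> assume "\<pi> \<in> ?E i j \<union> ?E j i"
    then show "\<pi> \<in> {\<pi>. wins (real m) (parallel_search m c \<pi>) ((i, y), (j, z))}"
      using wins_parallel_search_distinct(1)[OF m(1) x ij, of \<pi> c]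
        wins_parallel_search_distinct(2)[OF m(1) x' ij[symmetric], of \<pi> c]
      unfolding T by auto
  qed simp
  finally show ?thesis .
qed

lemma search_measure_ge:
  assumes m: "m \<ge> 1" "2 * real m \<le> real n + 1" and x: "x \<in> placements n"
  shows "2 * (real m)\<^sup>2 / (real n * (real n + 1)) \<le>
    measure (search_measure n m) {s \<in> space (search_measure n m). wins (real m) s x}"
proof -
  let ?p = "\<lambda>c. measure_pmf.prob (pmf_of_set {\<pi>. \<pi> permutes {..<n}}) {\<pi>. wins (real m) (parallel_search m c \<pi>) x}"
  let ?r = "2 * real m / (real n + 1)"
  obtain i y j z where x_eq: "x = ((i, y), (j, z))"
    by (metis prod.exhaust)
  have r: "0 \<le> ?r" "?r \<le> 1"
    using m by auto
  have n: "i < n" "j < n" "m \<le> n" "m + (m - 1) \<le> n"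
    using placements_pos[OF x[unfolded x_eq]] m by auto
  have "2 * (real m)\<^sup>2 / (real n * (real n + 1)) \<le> ?r * ?p True + (1 - ?r) * ?p False"
  proof (cases "i = j")
    case True
    have "2 * (real m)\<^sup>2 / (real n * (real n + 1)) = ?r * (real m / real n)"
      by (simp add: power2_eq_square mult_ac)
    also have "\<dots> \<le> ?r * ?p True"
      using prob_wins_same[OF m(1) n(3)] x True unfolding x_eq by (intro mult_left_mono r) auto
    also have "\<dots> \<le> ?r * ?p True + (1 - ?r) * ?p False"
      using r by simp
    finally show ?thesis .
  next
    case False
    define D where "D = real n * (real n - 1)"
    have n2: "2 \<le> n"
      using n False by auto
    have "2 * (real m)\<^sup>2 / (real n * (real n + 1)) = 2 * real m * (real m - ?r) / D"
    proof -
      \<comment> \<open>Here the choice of \<open>?r\<close> enters: the factor \<open>n - 1\<close>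
        cancels against \<open>D\<close>, leaving the same value as for a shared hole.\<close>
      have "real m - ?r = real m * (real n - 1) / (real n + 1)"
        by (simp add: field_simps)
      then show ?thesis
        using n2 by (simp add: D_def power2_eq_square)
    qed
    \<comment> \<open>\<open>m - ?r\<close> is the mean of \<open>m - 1\<close> and \<open>m\<close>
      with weights \<open>?r\<close> and \<open>1 - ?r\<close>.\<close>
    also have "\<dots> = ?r * (2 * real m * real (m - 1) / D) + (1 - ?r) * (2 * real m * real m / D)"
    proof -
      have "2 * k * (k - r) / D = r * (2 * k * (k - 1) / D) + (1 - r) * (2 * k * k / D)" for k r :: real
        by (simp add: add_divide_distrib diff_divide_distrib algebra_simps)
      then show ?thesis
        unfolding of_nat_diff[OF m(1)] of_nat_1 .
    qed
    also have "\<dots> \<le> ?r * ?p True + (1 - ?r) * ?p False"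
    proof (rule add_mono)
      show "?r * (2 * real m * real (m - 1) / D) \<le> ?r * ?p True"
        using prob_wins_distinct[of m True n i y j z] m n x False
        unfolding x_eq D_def by (intro mult_left_mono r) auto
      show "(1 - ?r) * (2 * real m * real m / D) \<le> (1 - ?r) * ?p False"
      proof (cases "2 * m \<le> n")
        case True
        then show ?thesis
          using prob_wins_distinct[of m False n i y j z] m n x False r
          unfolding x_eq D_def by (intro mult_left_mono) auto
      next
        case False
        \<comment> \<open>There are fewer than \<open>2 * m\<close> ranks, but then \<open>c\<close> holds almost surely.\<close>
        then have "2 * real m = real n + 1"
          using m(2) by linarith
        then show ?thesis
          by simp
      qed
    qed
    finally show ?thesis .
  qed
  then show ?thesis
    unfolding measure_search_measure[OF m] .
qed

subsection \<open>The value of the game\<close>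

text \<open>Tonelli in both orders: integrating over strategies transfers bounds valid for each pure
  strategy, integrating over placements transfers guarantees valid for each placement.\<close>

lemma emeasure_win_pair:
  assumes \<sigma>: "\<sigma> \<in> search_strategies n h" and \<mu>: "prob_space \<mu>" "sets \<mu> = sets borel"
  shows "emeasure (\<sigma> \<Otimes>\<^sub>M \<mu>) (SIGMA s:space \<sigma>. win_set n h s) = (\<integral>\<^sup>+s. emeasure \<mu> (win_set n h s) \<partial>\<sigma>)"
    and "emeasure (\<sigma> \<Otimes>\<^sub>M \<mu>) (SIGMA s:space \<sigma>. win_set n h s)
      = (\<integral>\<^sup>+x. emeasure \<sigma> {s \<in> space \<sigma>. x \<in> win_set n h s} \<partial>\<mu>)"
proof -
  interpret \<sigma>: prob_space \<sigma>
    using \<sigma> by (simp add: search_strategies_def)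
  interpret \<mu>: prob_space \<mu>
    by fact
  interpret pair_prob_space \<sigma> \<mu> ..
  have W: "(SIGMA s:space \<sigma>. win_set n h s) \<in> sets (\<sigma> \<Otimes>\<^sub>M \<mu>)"
    using \<sigma> \<mu>(2) by (simp add: search_strategies_def cong: sets_pair_measure_cong)
  show "emeasure (\<sigma> \<Otimes>\<^sub>M \<mu>) (SIGMA s:space \<sigma>. win_set n h s) = (\<integral>\<^sup>+s. emeasure \<mu> (win_set n h s) \<partial>\<sigma>)"
    unfolding \<mu>.emeasure_pair_measure_alt[OF W]
    by (intro nn_integral_cong arg_cong[of _ _ "emeasure \<mu>"]) auto
  show "emeasure (\<sigma> \<Otimes>\<^sub>M \<mu>) (SIGMA s:space \<sigma>. win_set n h s)
      = (\<integral>\<^sup>+x. emeasure \<sigma> {s \<in> space \<sigma>. x \<in> win_set n h s} \<partial>\<mu>)"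
    unfolding emeasure_pair_measure_alt2[OF W]
    by (intro nn_integral_cong arg_cong[of _ _ "emeasure \<sigma>"]) auto
qed

lemma win_prob_le:
  assumes \<sigma>: "\<sigma> \<in> search_strategies n h" and \<mu>: "prob_space \<mu>" "sets \<mu> = sets borel"
    and le: "\<And>s. s \<in> pure_strategies n h \<Longrightarrow> measure \<mu> (win_set n h s) \<le> v" and v: "0 \<le> v"
  shows "win_prob n h \<sigma> \<mu> \<le> v"
proof -
  interpret \<sigma>: prob_space \<sigma>
    using \<sigma> by (simp add: search_strategies_def)
  interpret \<mu>: prob_space \<mu>
    by fact
  have "emeasure (\<sigma> \<Otimes>\<^sub>M \<mu>) (SIGMA s:space \<sigma>. win_set n h s) \<le> (\<integral>\<^sup>+s. ennreal v \<partial>\<sigma>)"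
    unfolding emeasure_win_pair(1)[OF \<sigma> \<mu>]
  proof (rule nn_integral_mono)
    fix s assume "s \<in> space \<sigma>"
    then have "s \<in> pure_strategies n h"
      using \<sigma> by (auto simp: search_strategies_def)
    then show "emeasure \<mu> (win_set n h s) \<le> ennreal v"
      by (simp add: \<mu>.emeasure_eq_measure le ennreal_leI)
  qed
  then show ?thesis
    using v by (simp add: \<sigma>.emeasure_space_1 win_prob_def measure_def enn2real_leI)
qed

lemma win_prob_ge:
  assumes \<sigma>: "\<sigma> \<in> search_strategies n h"
    and \<mu>: "prob_space \<mu>" "sets \<mu> = sets borel" "AE x in \<mu>. x \<in> placements n"
    and ge: "\<And>x. x \<in> placements n \<Longrightarrow> v \<le> measure \<sigma> {s \<in> space \<sigma>. wins h s x}"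
  shows "v \<le> win_prob n h \<sigma> \<mu>"
proof -
  interpret \<sigma>: prob_space \<sigma>
    using \<sigma> by (simp add: search_strategies_def)
  interpret \<mu>: prob_space \<mu>
    by fact
  interpret pair_prob_space \<sigma> \<mu> ..
  have "(\<integral>\<^sup>+x. ennreal v \<partial>\<mu>) \<le> emeasure (\<sigma> \<Otimes>\<^sub>M \<mu>) (SIGMA s:space \<sigma>. win_set n h s)"
    unfolding emeasure_win_pair(2)[OF \<sigma> \<mu>(1,2)]
  proof (rule nn_integral_mono_AE)
    show "AE x in \<mu>. ennreal v \<le> emeasure \<sigma> {s \<in> space \<sigma>. x \<in> win_set n h s}"
      using \<mu>(3)
    proof eventually_elim
      case (elim x)
      then show ?case
        using ge[OF elim] by (simp add: win_set_def \<sigma>.emeasure_eq_measure ennreal_leI)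
    qed
  qed
  then have "ennreal v \<le> ennreal (win_prob n h \<sigma> \<mu>)"
    by (simp add: \<mu>.emeasure_space_1 win_prob_def P.emeasure_eq_measure)
  then show ?thesis
    by (simp add: win_prob_def ennreal_le_iff)
qed

lemma uniform_basic_strategy_hiding:
  "n \<ge> 1 \<Longrightarrow> uniform_basic_strategy n \<in> hiding_strategies n"
  by (simp add: hiding_strategies_def prob_space_uniform_basic_strategy sets_uniform_basic_strategy
      AE_uniform_basic_strategy)

lemma uniform_basic_strategy_bound:
  assumes "0 < h" "s \<in> pure_strategies n h"
  shows "measure (uniform_basic_strategy n) (win_set n h s) \<le> 2 * h\<^sup>2 / (real n * (real n + 1))"
proof -
  obtain a b where s: "s = (a, b)"
    by (rule prod.exhaust)
  interpret pure_search n h a b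
    using assms by unfold_locales (auto simp: s)
  show ?thesis
    unfolding s by (rule measure_win_set_le)
qed

text \<open>Any searcher played against \<open>\<mu>\<close> gets at most \<open>v\<close>, and any
  hider played against \<open>\<sigma>\<close> concedes at least \<open>v\<close>; this pins both
  one-sided values. Nonemptiness and bounds are collected because suprema and infima of reals are
  only conditionally complete.\<close>

lemma has_value_saddle:
  assumes n: "n \<ge> 1" and v: "0 \<le> v"
    and \<sigma>: "\<sigma> \<in> search_strategies n h" and \<mu>: "\<mu> \<in> hiding_strategies n"
    and ge: "\<And>x. x \<in> placements n \<Longrightarrow> v \<le> measure \<sigma> {s \<in> space \<sigma>. wins h s x}"
    and le: "\<And>s. s \<in> pure_strategies n h \<Longrightarrow> measure \<mu> (win_set n h s) \<le> v"
  shows "has_value n h v"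
proof -
  let ?f = "\<lambda>\<sigma> x. measure \<sigma> {s \<in> space \<sigma>. wins h s x}"
  have "((0, 1), (0, 1)) \<in> placements n"
    using n by (simp add: placements_same_iff)
  then have placements: "placements n \<noteq> {}" by blast
  have "space \<sigma> \<noteq> {}"
    using \<sigma> prob_space.not_empty by (auto simp: search_strategies_def)
  then have pure: "pure_strategies n h \<noteq> {}"
    using \<sigma> by (auto simp: search_strategies_def)
  have bdd_f: "bdd_below (?f \<tau> ` placements n)" for \<tau>
    by (intro bdd_belowI2[of _ 0]) simp
  have inf_le: "(INF x\<in>placements n. ?f \<tau> x) \<le> v" if "\<tau> \<in> search_strategies n h" for \<tau>
  proof -
    have "(INF x\<in>placements n. ?f \<tau> x) \<le> win_prob n h \<tau> \<mu>"
      using \<mu> by (intro win_prob_ge[OF that] cINF_lower bdd_f) (auto simp: hiding_strategies_def)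
    also have "\<dots> \<le> v"
      using \<mu> by (intro win_prob_le[OF that] le v) (auto simp: hiding_strategies_def)
    finally show ?thesis .
  qed
  have "v \<le> (INF x\<in>placements n. ?f \<sigma> x)"
    using placements ge by (rule cINF_greatest)
  moreover have "(INF x\<in>placements n. ?f \<sigma> x) \<le> lower_value n h"
    unfolding lower_value_def using \<sigma> inf_le by (intro cSUP_upper bdd_aboveI2[of _ _ v]) auto
  moreover have "lower_value n h \<le> v"
    unfolding lower_value_def using \<sigma> inf_le by (intro cSUP_least) auto
  ultimately have lower: "lower_value n h = v" by simp
  have le_sup: "v \<le> (SUP s\<in>pure_strategies n h. measure \<nu> (win_set n h s))" if "\<nu> \<in> hiding_strategies n" for \<nu>
  proof -
    interpret \<nu>: prob_space \<nu>
      using that by (simp add: hiding_strategies_def)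
    have upper: "measure \<nu> (win_set n h s) \<le> (SUP s\<in>pure_strategies n h. measure \<nu> (win_set n h s))"
      if "s \<in> pure_strategies n h" for s
      using that by (intro cSUP_upper bdd_aboveI2[of _ _ 1]) auto
    obtain s where "s \<in> pure_strategies n h"
      using pure by blast
    then have "0 \<le> (SUP s\<in>pure_strategies n h. measure \<nu> (win_set n h s))"
      using upper measure_nonneg order_trans by blast
    then have "win_prob n h \<sigma> \<nu> \<le> (SUP s\<in>pure_strategies n h. measure \<nu> (win_set n h s))"
      using that upper by (intro win_prob_le[OF \<sigma>]) (auto simp: hiding_strategies_def)
    moreover have "v \<le> win_prob n h \<sigma> \<nu>"
      using that by (intro win_prob_ge[OF \<sigma>] ge) (auto simp: hiding_strategies_def)
    ultimately show ?thesis by simp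
  qed
  have "upper_value n h \<le> (SUP s\<in>pure_strategies n h. measure \<mu> (win_set n h s))"
    unfolding upper_value_def using \<mu> le_sup by (intro cINF_lower bdd_belowI2[of _ v]) auto
  moreover have "(SUP s\<in>pure_strategies n h. measure \<mu> (win_set n h s)) \<le> v"
    using pure le by (rule cSUP_least)
  moreover have "v \<le> upper_value n h"
    unfolding upper_value_def using \<mu> le_sup by (intro cINF_greatest) auto
  ultimately have "upper_value n h = v" by simp
  with lower show ?thesis
    by (simp add: has_value_def)
qed

theorem theorem2p24:
  fixes n :: nat and h :: real
  assumes "n \<ge> 1" and "h > 0"
  shows "(\<forall>\<sigma> \<in> search_strategies n h.
            win_prob n h \<sigma> (uniform_basic_strategy n) \<le> 2 * h\<^sup>2 / (real n * (real n + 1)))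
       \<and> (h \<in> \<int> \<and> h \<le> (real n + 1) / 2 \<longrightarrow>
            has_value n h (2 * h\<^sup>2 / (real n * (real n + 1))))"
proof (intro conjI ballI impI)
  fix \<sigma> assume "\<sigma> \<in> search_strategies n h"
  then show "win_prob n h \<sigma> (uniform_basic_strategy n) \<le> 2 * h\<^sup>2 / (real n * (real n + 1))"
    using assms uniform_basic_strategy_hiding[OF assms(1)] uniform_basic_strategy_bound[OF assms(2)]
    by (intro win_prob_le) (auto simp: hiding_strategies_def)
next
  assume h: "h \<in> \<int> \<and> h \<le> (real n + 1) / 2"
  then obtain m :: nat where m: "h = real m"
    using assms(2) by (metis Ints_cases less_imp_le nonneg_int_cases of_int_0_le_iff of_int_of_nat_eq)
  then have "m \<ge> 1" "2 * real m \<le> real n + 1"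
    using assms(2) h by auto
  then show "has_value n h (2 * h\<^sup>2 / (real n * (real n + 1)))"
    unfolding m using assms(1) uniform_basic_strategy_bound[of "real m" _ n] assms(2) m
    by (intro has_value_saddle[OF _ _ search_measure_strategy uniform_basic_strategy_hiding]
        search_measure_ge) auto
qed

end
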